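(* Let $f\in DBP$ have degree $d$ and let $\varphi\in M_d$ be the conjugacy class of $f$. Then $K_{\mathrm{Coeff}}(f)=K_{\mathrm{Moduli}}(\varphi)$.
   Context: Fix an embedding $\overline{\mathbb{Q}}\subset\mathbb{C}$ and let $\Gamma=\mathrm{Gal}(\overline{\mathbb{Q}}/\mathbb{Q})$. For a polynomial $f$, $C_f$ is its set of critical points in $\mathbb{C}$ and $P_f=\overline{\bigcup_{n>0}f^{\circ n}(C_f)}$. $DBP$ is the set of polynomials $f\in\overline{\mathbb{Q}}[z]$ of degree at least $3$ whose critical values lie in $\{0,1\}$, having local degree exactly $2$ at every point of $f^{-1}(1)$, and with $P_f\subset\{0,1\}$. $\mathrm{Rat}_d$ is the set of rational maps of degree $d\ge2$ with coefficients in $\overline{\mathbb{Q}}$; $\Gamma$ acts on it by applying $\sigma$ to coefficients, $f\mapsto f^\sigma$. $M_d$ is the quotient of $\mathrm{Rat}_d$ by conjugation by Möbius transformations; the action descends: $\varphi^\sigma$ is the conjugacy class of $f^\sigma$ for any $f\in\varphi$. For $\varphi\in M_d$, $\mathrm{Stab}_\Gamma(\varphi)=\{\sigma\in\Gamma:\varphi^\sigma=\varphi\}$ and the field of moduli $K_{\mathrm{Moduli}}(\varphi)$ is the subfield of $\overline{\mathbb{Q}}$ fixed by $\mathrm{Stab}_\Gamma(\varphi)$. $K_{\mathrm{Coeff}}(f)$ is the field generated over $\mathbb{Q}$ by the coefficients of $f$. *)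

theory Defs
  imports
    "HOL-Algebra.Algebraic_Closure_Type"
    "HOL-Algebra.Generated_Fields"
    "HOL-Analysis.Analysis"
    "HOL-Computational_Algebra.Computational_Algebra"
    "HOL-Computational_Algebra.Field_as_Ring"
begin

definition Qbar :: "complex set" where
  "Qbar = {z. algebraic z}"

definition Qbar_ring :: "complex ring" where
  "Qbar_ring = ring_of_type_algebra\<lparr>carrier := Qbar\<rparr>"

text \<open>Automorphisms are required to be extensional, so that each automorphism of \<open>Qbar\<close> is
  represented by exactly one function on the ambient type.\<close>

definition Galois_group :: "(complex \<Rightarrow> complex) set" where
  "Galois_group = {\<sigma> \<in> ring_iso Qbar_ring Qbar_ring. \<sigma> \<in> extensional Qbar \<and> (\<forall>x\<in>\<rat>. \<sigma> x = x)}"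

text \<open>The Riemann sphere is \<open>complex option\<close>, with \<open>None\<close> as the point at infinity. The value
  there is the quotient of the coefficients in degree \<open>max (degree p) (degree q)\<close>, as dictated by
  homogenising. The definition is meaningful only for coprime \<open>p\<close> and \<open>q\<close>.\<close>

definition ratmap :: "complex poly \<Rightarrow> complex poly \<Rightarrow> complex option \<Rightarrow> complex option" where
  "ratmap p q w = (case w of
      Some z \<Rightarrow> if poly q z = 0 then None else Some (poly p z / poly q z)
    | None \<Rightarrow> (let d = max (degree p) (degree q) in
        if Polynomial.coeff q d = 0 then None
        else Some (Polynomial.coeff p d / Polynomial.coeff q d)))"

definition over_Qbar :: "complex poly \<Rightarrow> bool" where
  "over_Qbar p \<longleftrightarrow> (\<forall>i. Polynomial.coeff p i \<in> Qbar)"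

definition Rat :: "nat \<Rightarrow> (complex option \<Rightarrow> complex option) set" where
  "Rat d = {ratmap p q | p q. over_Qbar p \<and> over_Qbar q \<and> coprime p q \<and>
     max (degree p) (degree q) = d}"

definition Moebius :: "(complex option \<Rightarrow> complex option) set" where
  "Moebius = {ratmap [:b, a:] [:d, c:] | a b c d.
     a \<in> Qbar \<and> b \<in> Qbar \<and> c \<in> Qbar \<and> d \<in> Qbar \<and> a * d - b * c \<noteq> 0}"

definition rat_conj ::
    "nat \<Rightarrow> ((complex option \<Rightarrow> complex option) \<times> (complex option \<Rightarrow> complex option)) set" where
  "rat_conj d = {(f, g). f \<in> Rat d \<and> g \<in> Rat d \<and>
     (\<exists>M\<in>Moebius. g = M \<circ> f \<circ> inv_into UNIV M)}"

definition Moduli :: "nat \<Rightarrow> (complex option \<Rightarrow> complex option) set set" where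
  "Moduli d = Rat d // rat_conj d"

definition conj_class ::
    "nat \<Rightarrow> (complex option \<Rightarrow> complex option) \<Rightarrow> (complex option \<Rightarrow> complex option) set" where
  "conj_class d f = rat_conj d `` {f}"

text \<open>The lowest-terms representation is unique up to a common scalar; the lemma
  \<open>gal_rat_ratmap\<close> below shows that the description is well defined.\<close>

definition gal_rat ::
    "(complex \<Rightarrow> complex) \<Rightarrow> (complex option \<Rightarrow> complex option) \<Rightarrow>
     (complex option \<Rightarrow> complex option)" where
  "gal_rat \<sigma> f = (THE g. \<exists>p q. over_Qbar p \<and> over_Qbar q \<and> coprime p q \<and> f = ratmap p q \<and>
     g = ratmap (map_poly \<sigma> p) (map_poly \<sigma> q))"

text \<open>The sets in this union all coincide, since the action on maps respects conjugacy.\<close>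

definition gal_class ::
    "nat \<Rightarrow> (complex \<Rightarrow> complex) \<Rightarrow> (complex option \<Rightarrow> complex option) set \<Rightarrow>
     (complex option \<Rightarrow> complex option) set" where
  "gal_class d \<sigma> \<phi> = (\<Union>f\<in>\<phi>. conj_class d (gal_rat \<sigma> f))"

definition Stab ::
    "nat \<Rightarrow> (complex option \<Rightarrow> complex option) set \<Rightarrow> (complex \<Rightarrow> complex) set" where
  "Stab d \<phi> = {\<sigma> \<in> Galois_group. gal_class d \<sigma> \<phi> = \<phi>}"

definition K_Moduli :: "nat \<Rightarrow> (complex option \<Rightarrow> complex option) set \<Rightarrow> complex set" where
  "K_Moduli d \<phi> = {x \<in> Qbar. \<forall>\<sigma>\<in>Stab d \<phi>. \<sigma> x = x}"

definition K_Coeff :: "complex poly \<Rightarrow> complex set" where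
  "K_Coeff f = generate_field ring_of_type_algebra (\<rat> \<union> range (Polynomial.coeff f))"

definition critical_points :: "complex poly \<Rightarrow> complex set" where
  "critical_points f = {z. poly (pderiv f) z = 0}"

definition postcritical_set :: "complex poly \<Rightarrow> complex set" where
  "postcritical_set f = closure (\<Union>n\<in>{0<..}. (poly f ^^ n) ` critical_points f)"

definition local_degree :: "complex poly \<Rightarrow> complex \<Rightarrow> nat" where
  "local_degree f z = Polynomial.order z (f - [:poly f z:])"

definition DBP :: "complex poly set" where
  "DBP = {f. over_Qbar f \<and> degree f \<ge> 3 \<and>
     poly f ` critical_points f \<subseteq> {0, 1} \<and>
     (\<forall>z. poly f z = 1 \<longrightarrow> local_degree f z = 2) \<and>
     postcritical_set f \<subseteq> {0, 1}}"

lemma Galois_group_mult: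
  assumes "\<sigma> \<in> Galois_group" "x \<in> Qbar" "y \<in> Qbar"
  shows "\<sigma> (x * y) = \<sigma> x * \<sigma> y"
  using assms by (auto simp: Galois_group_def ring_iso_def ring_hom_def Qbar_ring_def
      ring_of_type_algebra_def)

lemma Galois_group_0: "\<sigma> \<in> Galois_group \<Longrightarrow> \<sigma> 0 = 0"
  by (auto simp: Galois_group_def)

lemma Galois_group_nonzero:
  assumes "\<sigma> \<in> Galois_group" "x \<in> Qbar" "x \<noteq> 0"
  shows "\<sigma> x \<noteq> 0"
proof -
  have "inj_on \<sigma> Qbar"
    using assms by (auto simp: Galois_group_def ring_iso_def Qbar_ring_def bij_betw_def)
  moreover have "(0::complex) \<in> Qbar" by (simp add: Qbar_def)
  ultimately show ?thesis
    using assms Galois_group_0[OF assms(1)] by (metis inj_onD)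
qed

lemma ratmap_smult:
  assumes "c \<noteq> 0"
  shows "ratmap (smult c p) (smult c q) = ratmap p q"
  using assms by (auto simp: ratmap_def Let_def fun_eq_iff split: option.splits)

lemma ratmap_unique:
  assumes "coprime p q" "coprime p' q'" "ratmap p q = ratmap p' q'"
  obtains c where "c \<noteq> 0" "p' = smult c p" "q' = smult c q"
proof -
  have "poly (p * q') z = poly (p' * q) z" for z
    using fun_cong[OF assms(3), of "Some z"]
    by (auto simp: ratmap_def field_simps split: if_splits)
  then have eq: "p * q' = p' * q"
    by (simp flip: poly_eq_poly_eq_iff add: fun_eq_iff)
  have "q dvd q'"
    using assms(1) eq coprime_dvd_mult_right_iff[of q p q'] by (simp add: coprime_commute)
  moreover have "q' dvd q"
    using assms(2) eq[symmetric] coprime_dvd_mult_right_iff[of q' p' q]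
    by (simp add: coprime_commute)
  ultimately have deg: "q = 0 \<longleftrightarrow> q' = 0"
    by auto
  have deg': "degree q' = degree q" if "q \<noteq> 0"
    using that deg dvd_imp_degree_le[OF \<open>q dvd q'\<close>] dvd_imp_degree_le[OF \<open>q' dvd q\<close>]
    by simp
  show thesis
  proof (cases "q = 0")
    case True
    then have "is_unit p" "is_unit p'" using assms deg by auto
    then have ne: "p \<noteq> 0" "p' \<noteq> 0" by auto
    have deg0: "degree p = 0" "degree p' = 0"
      using \<open>is_unit p\<close> \<open>is_unit p'\<close> is_unit_iff_degree[OF ne(1)] is_unit_iff_degree[OF ne(2)]
      by simp_all
    obtain a where a: "p = [:a:]" using deg0(1) by (rule degree_eq_zeroE)
    obtain b where b: "p' = [:b:]" using deg0(2) by (rule degree_eq_zeroE)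
    have "a \<noteq> 0" "b \<noteq> 0" using ne a b by simp_all
    then show thesis using that[of "b / a"] True deg a b by simp
  next
    case False
    obtain u where u: "q' = q * u" using \<open>q dvd q'\<close> by (elim dvdE)
    have "u \<noteq> 0" using False deg u by (metis mult_zero_right)
    have "degree q' = degree q + degree u"
      unfolding u by (rule degree_mult_eq[OF False \<open>u \<noteq> 0\<close>])
    then have "degree u = 0" using deg'[OF False] by linarith
    then obtain c where c: "u = [:c:]" by (rule degree_eq_zeroE)
    have "c \<noteq> 0" using \<open>u \<noteq> 0\<close> c by simp
    have q': "q' = smult c q" using u c by simp
    have "q * p' = q * smult c p" using eq q' by (simp add: mult.commute)
    then have "p' = smult c p" using mult_left_cancel[OF False] by (rule iffD1[rotated])
    then show thesis using that[OF \<open>c \<noteq> 0\<close>] q' by blast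
  qed
qed

lemma gal_rat_ratmap:
  assumes \<sigma>: "\<sigma> \<in> Galois_group" and Q: "over_Qbar p" "over_Qbar q" and cop: "coprime p q"
  shows "gal_rat \<sigma> (ratmap p q) = ratmap (map_poly \<sigma> p) (map_poly \<sigma> q)"
  unfolding gal_rat_def
proof (rule the_equality)
  show "\<exists>r s. over_Qbar r \<and> over_Qbar s \<and> coprime r s \<and> ratmap p q = ratmap r s \<and>
      ratmap (map_poly \<sigma> p) (map_poly \<sigma> q) = ratmap (map_poly \<sigma> r) (map_poly \<sigma> s)"
    using assms by blast
next
  fix g
  assume "\<exists>r s. over_Qbar r \<and> over_Qbar s \<and> coprime r s \<and> ratmap p q = ratmap r s \<and>
      g = ratmap (map_poly \<sigma> r) (map_poly \<sigma> s)"
  then obtain r s where rs: "over_Qbar r" "over_Qbar s" "coprime r s"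
      "ratmap p q = ratmap r s" "g = ratmap (map_poly \<sigma> r) (map_poly \<sigma> s)"
    by blast
  obtain c where c: "c \<noteq> 0" "r = smult c p" "s = smult c q"
    using ratmap_unique[OF cop rs(3,4)] by blast
  have "p \<noteq> 0 \<or> q \<noteq> 0" using cop by auto
  then obtain t where t: "t \<noteq> 0" "over_Qbar t" "over_Qbar (smult c t)"
    using Q rs(1,2) c by blast
  define x where "x = Polynomial.lead_coeff t"
  have x: "x \<in> Qbar" "c * x \<in> Qbar" "x \<noteq> 0"
    using t by (auto simp: x_def over_Qbar_def)
  define k where "k = \<sigma> (c * x) / \<sigma> x"
  have k: "k \<noteq> 0"
    using x c(1) Galois_group_nonzero[OF \<sigma>] by (simp add: k_def)
  have map: "map_poly \<sigma> (smult c t) = smult k (map_poly \<sigma> t)"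
    if "over_Qbar t" "over_Qbar (smult c t)" for t
  proof (rule poly_eqI)
    fix i
    let ?y = "Polynomial.coeff t i"
    have y: "?y \<in> Qbar" "c * ?y \<in> Qbar" using that by (auto simp: over_Qbar_def)
    have "\<sigma> (c * ?y) * \<sigma> x = \<sigma> (c * ?y * x)"
      using Galois_group_mult[OF \<sigma> y(2) x(1)] by simp
    also have "c * ?y * x = (c * x) * ?y" by simp
    also have "\<sigma> \<dots> = \<sigma> (c * x) * \<sigma> ?y"
      using Galois_group_mult[OF \<sigma> x(2) y(1)] .
    finally have "\<sigma> (c * ?y) = k * \<sigma> ?y"
      using Galois_group_nonzero[OF \<sigma> x(1,3)] by (simp add: k_def field_simps)
    then show "Polynomial.coeff (map_poly \<sigma> (smult c t)) i =
        Polynomial.coeff (smult k (map_poly \<sigma> t)) i"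
      by (simp add: coeff_map_poly Galois_group_0[OF \<sigma>])
  qed
  show "g = ratmap (map_poly \<sigma> p) (map_poly \<sigma> q)"
    using rs c Q map[of p] map[of q] k by (simp add: ratmap_smult)
qed

lemma DBP_in_Rat:
  assumes "f \<in> DBP"
  shows "ratmap f 1 \<in> Rat (degree f)"
proof -
  have "over_Qbar 1" by (auto simp: over_Qbar_def Qbar_def)
  then show ?thesis
    using assms unfolding Rat_def DBP_def
    by (intro CollectI exI[of _ f] exI[of _ 1]) auto
qed

lemma DBP_class_in_Moduli:
  assumes "f \<in> DBP"
  shows "conj_class (degree f) (ratmap f 1) \<in> Moduli (degree f)"
  using DBP_in_Rat[OF assms] by (simp add: Moduli_def conj_class_def quotientI)

lemma id_in_Moebius: "id \<in> Moebius"
proof -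
  have "ratmap [:0, 1:] [:1, 0:] = id"
    by (auto simp: ratmap_def fun_eq_iff split: option.splits)
  moreover have "(0::complex) \<in> Qbar" "(1::complex) \<in> Qbar"
    by (auto simp: Qbar_def)
  ultimately show ?thesis
    unfolding Moebius_def
    by (intro CollectI exI[of _ 1] exI[of _ 0] exI[of _ 0] exI[of _ 1]) simp
qed

lemma conj_class_self:
  assumes "f \<in> Rat d"
  shows "f \<in> conj_class d f"
proof -
  have "f = id \<circ> f \<circ> inv_into UNIV id" by simp
  then have "\<exists>M\<in>Moebius. f = M \<circ> f \<circ> inv_into UNIV M"
    using id_in_Moebius by (intro bexI[of _ id])
  then show ?thesis
    using assms unfolding conj_class_def rat_conj_def by simp
qed

end

(* Let f be a DBP polynomial and sigma an automorphism of Qbar. If f^sigma = M f M^-1 for a Moebius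
   map M, then M fixes infinity, because f has no finite exceptional point: otherwise f would be
   e + c (z - e)^n with e as its only critical point, hence e = 1, but the local degree there is 2 < n.
   Both 0 and 1 are critical values of f and of f^sigma, so the affine map M permutes {0, 1}; counting
   critical points shows that it fixes both, so M is the identity and f^sigma = f. Conversely
   f^sigma = f implies that sigma preserves the conjugacy class, so the stabiliser of the class is
   the group fixing K_Coeff f pointwise, whose fixed field is K_Coeff f by Galois theory. *)
theory Submission
  imports Defs
begin

section \<open>Algebraic numbers\<close>

text \<open>The obstacle is that an automorphism acts on \<open>Qbar\<close> only, while a rational
  map is a function on the whole Riemann sphere. Applying \<sigma> to an equality of maps says
  nothing at transcendental points; these are reached through polynomials, which are determined by
  their values on the infinite set \<open>Qbar\<close>. The affine case rests on two counts, with n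
  the degree of f. The fibre over 1 consists of n/2 double points. Without a critical point over 0,
  all n - 1 critical points would be simple and lie in that fibre, so n - 1 <= n/2, impossible for n
  >= 3. If M exchanged 0 and 1, the fibre over 0 would also consist of n/2 double points, giving n
  critical points although f' has degree n - 1. The Galois theory is reduced to one statement: an
  algebraic number x outside a field K between the rationals and \<open>Qbar\<close> is moved by an
  automorphism fixing K pointwise. It sends x to another root of a minimal polynomial of x and is
  extended to \<open>Qbar\<close> by Zorn's lemma.\<close>

interpretation C: domain "ring_of_type_algebra :: complex ring"
  by (rule field.axioms(1)[OF field_from_type_algebra])

lemma ring_of_type_algebra_simps [simp]:
  "carrier ring_of_type_algebra = UNIV"
  "x \<otimes>\<^bsub>ring_of_type_algebra\<^esub> y = x * y"
  "x \<oplus>\<^bsub>ring_of_type_algebra\<^esub> y = x + y"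
  "\<one>\<^bsub>ring_of_type_algebra\<^esub> = 1"
  "\<zero>\<^bsub>ring_of_type_algebra\<^esub> = 0"
  by (simp_all add: ring_of_type_algebra_def)

lemma a_inv_complex [simp]: "\<ominus>\<^bsub>ring_of_type_algebra\<^esub> x = - (x :: complex)"
  using C.minus_equality[of "- x" x] by simp

lemma nat_pow_complex [simp]: "(x::complex) [^]\<^bsub>ring_of_type_algebra\<^esub> (n::nat) = x ^ n"
  by (induction n) simp_all

lemma m_inv_complex [simp]: "x \<noteq> 0 \<Longrightarrow> inv\<^bsub>ring_of_type_algebra\<^esub> x = inverse (x :: complex)"
  by (rule C.comm_inv_char) simp_all

lemma Poly_snoc: "Poly (xs @ [c]) = Poly xs + monom c (length xs)"
  by (induction xs) (simp_all add: monom_Suc monom_0)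

text \<open>Polynomials of HOL-Algebra are coefficient lists with the leading coefficient first,
  whereas \<open>Poly\<close> expects the constant term first; hence \<open>rev\<close> here and
  below.\<close>

lemma eval_eq_poly: "C.eval xs x = poly (Poly (rev xs)) x"
  by (induction xs) (simp_all add: Poly_snoc poly_monom)

lemma coeff_Poly_rev_nonzero:
  assumes "xs \<noteq> []" "hd xs \<noteq> 0"
  shows "Poly (rev xs) \<noteq> 0"
proof -
  have "Polynomial.coeff (Poly (rev xs)) (length xs - 1) = hd xs"
    using assms by (simp add: nth_default_def rev_nth hd_conv_nth)
  then show ?thesis using assms(2) by (metis coeff_0)
qed

lemma algebraic_over_iff:
  assumes "subring K (ring_of_type_algebra :: complex ring)"
  shows "(C.algebraic over K) x \<longleftrightarrow>
    (\<exists>p. (\<forall>i. Polynomial.coeff p i \<in> K) \<and> p \<noteq> 0 \<and> poly p x = 0)"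
proof
  assume "(C.algebraic over K) x"
  then obtain xs where xs: "xs \<in> carrier (K [X]\<^bsub>ring_of_type_algebra\<^esub>)" "xs \<noteq> []" "C.eval xs x = 0"
    using C.algebraicE[OF assms] by auto
  then have "set xs \<subseteq> K" "hd xs \<noteq> 0"
    by (auto simp: univ_poly_def polynomial_def)
  moreover have "0 \<in> K" using subringE(2)[OF assms] by simp
  ultimately have "\<forall>i. Polynomial.coeff (Poly (rev xs)) i \<in> K"
    by (auto simp: nth_default_def rev_nth)
  then show "\<exists>p. (\<forall>i. Polynomial.coeff p i \<in> K) \<and> p \<noteq> 0 \<and> poly p x = 0"
    using xs coeff_Poly_rev_nonzero \<open>hd xs \<noteq> 0\<close> eval_eq_poly by metis
next
  assume "\<exists>p. (\<forall>i. Polynomial.coeff p i \<in> K) \<and> p \<noteq> 0 \<and> poly p x = 0"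
  then obtain p where p: "\<And>i. Polynomial.coeff p i \<in> K" "p \<noteq> 0" "poly p x = 0" by blast
  have "set (coeffs p) \<subseteq> K" using p(1) by (auto simp: coeffs_def)
  moreover have "hd (rev (coeffs p)) \<noteq> 0"
    using p(2) by (simp add: hd_rev last_coeffs_eq_coeff_degree)
  ultimately have "rev (coeffs p) \<in> carrier (K [X]\<^bsub>ring_of_type_algebra\<^esub>)"
    by (auto simp: univ_poly_def polynomial_def)
  then show "(C.algebraic over K) x"
    by (rule C.algebraicI) (use p in \<open>simp_all add: eval_eq_poly\<close>)
qed

lemma subfield_Rats: "subfield \<rat> (ring_of_type_algebra :: complex ring)"
  by (intro field.subfieldI' C.subringI) auto

lemma Qbar_eq_algebraics: "Qbar = {x. (C.algebraic over \<rat>) x}"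
  using algebraic_over_iff[OF subfieldE(1)[OF subfield_Rats]]
  by (auto simp: Qbar_def algebraic_altdef)

lemma subfield_Qbar: "subfield Qbar (ring_of_type_algebra :: complex ring)"
  using field.subfield_of_algebraics[OF field_from_type_algebra subfield_Rats] by (simp add: Qbar_eq_algebraics)

lemma Qbar_add: "x \<in> Qbar \<Longrightarrow> y \<in> Qbar \<Longrightarrow> x + y \<in> Qbar"
  using subringE(7)[OF subfieldE(1)[OF subfield_Qbar], of x y] by simp

lemma Qbar_mult: "x \<in> Qbar \<Longrightarrow> y \<in> Qbar \<Longrightarrow> x * y \<in> Qbar"
  using subringE(6)[OF subfieldE(1)[OF subfield_Qbar], of x y] by simp

lemma Rats_subset_Qbar: "\<rat> \<subseteq> Qbar"
  by (auto simp: Qbar_def rat_imp_algebraic)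

lemma Qbar_uminus: "x \<in> Qbar \<Longrightarrow> - x \<in> Qbar"
  by (simp add: Qbar_def)

lemma Qbar_inverse: "x \<in> Qbar \<Longrightarrow> inverse x \<in> Qbar"
  by (auto simp: Qbar_def)

lemma Qbar_diff: "x \<in> Qbar \<Longrightarrow> y \<in> Qbar \<Longrightarrow> x - y \<in> Qbar"
  using Qbar_add[of x "- y"] by (simp add: Qbar_uminus)

lemma Qbar_divide: "x \<in> Qbar \<Longrightarrow> y \<in> Qbar \<Longrightarrow> x / y \<in> Qbar"
  by (simp add: divide_inverse Qbar_mult Qbar_inverse)

text \<open>The coefficients generate a finite extension F of the rationals and x is algebraic over
  F, so by the tower law x lies in a finite extension of the rationals.\<close>

lemma root_in_Qbar:
  assumes "over_Qbar p" "p \<noteq> 0" "poly p x = 0"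
  shows "x \<in> Qbar"
proof -
  define F where "F = C.finite_extension \<rat> (coeffs p)"
  have alg: "(C.algebraic over \<rat>) c" if "c \<in> set (coeffs p)" for c
    using that assms(1) by (auto simp: coeffs_def over_Qbar_def Qbar_eq_algebraics split: if_splits)
  have sub: "subfield F ring_of_type_algebra"
    unfolding F_def by (rule C.finite_extension_is_subfield[OF subfield_Rats _ alg]) auto
  have fin: "C.finite_dimension \<rat> F"
    unfolding F_def by (rule C.finite_extension_finite_dimension(1)[OF subfield_Rats _ alg]) auto
  have "set (coeffs p) \<subseteq> F"
    unfolding F_def by (rule C.finite_extension_mem[OF subfieldE(1)[OF subfield_Rats]]) auto
  moreover have "0 \<in> F" using subringE(2)[OF subfieldE(1)[OF sub]] by simp
  ultimately have "\<forall>i. Polynomial.coeff p i \<in> F"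
    using range_coeff[of p] by (metis insert_subset rangeI subsetD)
  then have x: "(C.algebraic over F) x"
    using assms(2,3) algebraic_over_iff[OF subfieldE(1)[OF sub]] by blast
  then have "C.finite_dimension F (C.simple_extension F x)"
    using C.finite_dimension_simple_extension[OF sub] by simp
  with fin have "C.finite_dimension \<rat> (C.simple_extension F x)"
    using C.telescopic_base[OF subfield_Rats sub] unfolding C.finite_dimension_def by blast
  then show ?thesis
    using C.finite_dimension_imp_algebraic[OF subfield_Rats
        C.simple_extension_is_subring[OF subfieldE(1)[OF sub]]]
      C.simple_extension_mem[OF subfieldE(1)[OF sub], of x]
    by (simp add: Qbar_eq_algebraics)
qed

section \<open>Automorphisms of the field of algebraic numbers\<close>

text \<open>Ring homomorphisms defined on part of \<open>Qbar\<close> are represented by their graphs, so that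
  extension is inclusion. No field axiom is demanded of the domain: a subring of \<open>Qbar\<close> that
  contains the rationals is a field.\<close>

definition graph_hom :: "(complex \<times> complex) set \<Rightarrow> bool" where
  "graph_hom G \<longleftrightarrow> Domain G \<subseteq> Qbar \<and> (\<forall>q\<in>\<rat>. (q, q) \<in> G) \<and>
     (\<forall>x u y v. (x, u) \<in> G \<longrightarrow> (y, v) \<in> G \<longrightarrow> (x + y, u + v) \<in> G \<and> (x * y, u * v) \<in> G) \<and>
     (\<forall>u. (0, u) \<in> G \<longrightarrow> u = 0)"

text \<open>If \<open>G\<close> is the graph of a homomorphism, \<open>p'\<close> is the image of
  \<open>p\<close> under it, coefficient by coefficient.\<close>

definition paired :: "(complex \<times> complex) set \<Rightarrow> complex poly \<Rightarrow> complex poly \<Rightarrow> bool" where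
  "paired G p p' \<longleftrightarrow> (\<forall>i. (Polynomial.coeff p i, Polynomial.coeff p' i) \<in> G)"

text \<open>The would-be graph of the extension sending \<alpha> to \<beta>. As a relation it makes
  sense for every \<beta>; that it is single-valued becomes a claim about roots.\<close>

definition simple_ext ::
    "(complex \<times> complex) set \<Rightarrow> complex \<Rightarrow> complex \<Rightarrow> (complex \<times> complex) set" where
  "simple_ext G \<alpha> \<beta> = {(poly p \<alpha>, poly p' \<beta>) | p p'. paired G p p'}"

text \<open>Divide a rational relation for x by x until its constant term a is nonzero; then x q(x)
  = -a, so the inverse of x is -q(x)/a.\<close>

lemma subring_inverse_closed:
  assumes "A \<subseteq> Qbar" "\<rat> \<subseteq> A"
    and add: "\<And>x y. x \<in> A \<Longrightarrow> y \<in> A \<Longrightarrow> x + y \<in> A"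
    and mult: "\<And>x y. x \<in> A \<Longrightarrow> y \<in> A \<Longrightarrow> x * y \<in> A"
    and x: "x \<in> A"
  shows "inverse x \<in> A"
proof (cases "x = 0")
  case True
  then show ?thesis using x by simp
next
  case False
  have poly_in: "poly p x \<in> A" if "\<forall>i. Polynomial.coeff p i \<in> \<rat>" for p
    using that
  proof (induction p)
    case 0
    show ?case using assms(2) by auto
  next
    case (pCons a p)
    have "\<forall>i. Polynomial.coeff p i \<in> \<rat>"
      using pCons.prems by (metis coeff_pCons_Suc)
    moreover have "a \<in> A" using pCons.prems assms(2) by (metis coeff_pCons_0 subsetD)
    ultimately show ?case using pCons.IH add mult x by simp
  qed
  have inv: "inverse x \<in> A"
    if "\<forall>i. Polynomial.coeff p i \<in> \<rat>" "p \<noteq> 0" "poly p x = 0" for p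
    using that
  proof (induction p)
    case 0
    then show ?case by simp
  next
    case (pCons a p)
    have p: "\<forall>i. Polynomial.coeff p i \<in> \<rat>" and a: "a \<in> \<rat>"
      using pCons.prems(1) by (metis coeff_pCons_Suc, metis coeff_pCons_0)
    show ?case
    proof (cases "a = 0")
      case True
      then show ?thesis using pCons p False by auto
    next
      case a0: False
      have "x * poly p x = - a" using pCons.prems(3) by (simp add: eq_neg_iff_add_eq_0 add.commute)
      then have "inverse x = - inverse a * poly p x"
        using a0 False by (simp add: field_simps)
      moreover have "- inverse a \<in> A" using a assms(2) by auto
      ultimately show ?thesis using mult[OF _ poly_in[OF p]] by metis
    qed
  qed
  have "algebraic x" using assms(1) x by (auto simp: Qbar_def)
  then show ?thesis using inv unfolding algebraic_altdef by blast
qed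

section \<open>Homomorphisms on subfields of \<open>Qbar\<close> and their simple extensions\<close>

context
  fixes G
  assumes G: "graph_hom G"
begin

lemma graph_hom_Rats: "q \<in> \<rat> \<Longrightarrow> (q, q) \<in> G"
  and graph_hom_add: "(x, u) \<in> G \<Longrightarrow> (y, v) \<in> G \<Longrightarrow> (x + y, u + v) \<in> G"
  and graph_hom_mult: "(x, u) \<in> G \<Longrightarrow> (y, v) \<in> G \<Longrightarrow> (x * y, u * v) \<in> G"
  and graph_hom_0: "(0, u) \<in> G \<Longrightarrow> u = 0"
  using G unfolding graph_hom_def by blast+

lemma graph_hom_diff: "(x, u) \<in> G \<Longrightarrow> (y, v) \<in> G \<Longrightarrow> (x - y, u - v) \<in> G"
  using graph_hom_add[of x u "-1 * y" "-1 * v"] graph_hom_mult[of "-1" "-1" y v] graph_hom_Rats[of "-1"]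
  by simp

text \<open>\<open>graph_hom\<close> asks for uniqueness of the value at 0 only; differences carry
  it to every point.\<close>

lemma graph_hom_functional: "(x, u) \<in> G \<Longrightarrow> (x, v) \<in> G \<Longrightarrow> u = v"
  using graph_hom_diff[of x u x v] graph_hom_0[of "u - v"] by simp

lemma graph_hom_inverse:
  assumes "x \<in> Domain G"
  shows "inverse x \<in> Domain G"
proof (rule subring_inverse_closed[OF _ _ _ _ assms])
  show "Domain G \<subseteq> Qbar" using G by (simp add: graph_hom_def)
  show "\<rat> \<subseteq> Domain G" using graph_hom_Rats by blast
qed (blast intro: graph_hom_add graph_hom_mult)+

lemma graph_hom_inj:
  assumes "(x, 0) \<in> G"
  shows "x = 0"
proof (rule ccontr)
  assume "x \<noteq> 0"
  obtain w where "(inverse x, w) \<in> G" using graph_hom_inverse assms by blast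
  then have "(1, 0) \<in> G" using graph_hom_mult[OF assms] \<open>x \<noteq> 0\<close> by fastforce
  then show False using graph_hom_functional[of 1 0 1] graph_hom_Rats[of 1] by simp
qed

lemma graph_hom_sum:
  assumes "\<And>i. i \<in> I \<Longrightarrow> (g i, h i) \<in> G"
  shows "(sum g I, sum h I) \<in> G"
  using assms
  by (induction I rule: infinite_finite_induct) (auto intro: graph_hom_add graph_hom_Rats)

lemma paired_0: "paired G 0 p' \<Longrightarrow> p' = 0"
  using graph_hom_0 by (auto simp: paired_def poly_eq_iff)

lemma paired_add: "paired G p p' \<Longrightarrow> paired G q q' \<Longrightarrow> paired G (p + q) (p' + q')"
  by (simp add: paired_def graph_hom_add)

lemma paired_diff: "paired G p p' \<Longrightarrow> paired G q q' \<Longrightarrow> paired G (p - q) (p' - q')"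
  by (simp add: paired_def graph_hom_diff)

lemma paired_mult: "paired G p p' \<Longrightarrow> paired G q q' \<Longrightarrow> paired G (p * q) (p' * q')"
  by (simp add: paired_def coeff_mult graph_hom_sum graph_hom_mult)

lemma paired_monom: "(a, b) \<in> G \<Longrightarrow> paired G (monom a n) (monom b n)"
  using graph_hom_Rats[of 0] by (simp add: paired_def)

lemma paired_poly:
  assumes "paired G p p'" "(x, u) \<in> G"
  shows "(poly p x, poly p' u) \<in> G"
  using assms(1)
proof (induction p arbitrary: p')
  case 0
  then have "p' = 0" by (rule paired_0)
  then show ?case using graph_hom_Rats[of 0] by simp
next
  case (pCons a p)
  obtain b q where p': "p' = pCons b q" by (rule pCons_cases)
  have "(a, b) \<in> G" "paired G p q"
    using pCons.prems unfolding paired_def p' by (metis coeff_pCons_0, metis coeff_pCons_Suc)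
  then show ?case
    using pCons.IH assms(2) by (simp add: p' graph_hom_add graph_hom_mult)
qed

text \<open>The polynomials vanishing at \<alpha> are the multiples of one of least degree, so it
  suffices that \<beta> is a root of the image of that one.\<close>

lemma graph_hom_simple_ext:
  assumes \<alpha>: "\<alpha> \<in> Qbar"
    and m: "paired G m m'" "m \<noteq> 0" "poly m \<alpha> = 0" "poly m' \<beta> = 0"
    and min: "\<And>p p'. paired G p p' \<Longrightarrow> p \<noteq> 0 \<Longrightarrow> poly p \<alpha> = 0 \<Longrightarrow>
      Polynomial.degree m \<le> Polynomial.degree p"
  shows "graph_hom (simple_ext G \<alpha> \<beta>)" "G \<subseteq> simple_ext G \<alpha> \<beta>" "(\<alpha>, \<beta>) \<in> simple_ext G \<alpha> \<beta>"
proof -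
  let ?k = "Polynomial.degree m"
  \<comment> \<open>The index is the degree of m: this coefficient of m' is nonzero because
    \<open>G\<close> is injective.\<close>
  have lead: "Polynomial.coeff m' ?k \<noteq> 0"
    using m(1,2) graph_hom_inj leading_coeff_0_iff unfolding paired_def by metis
  have zero: "poly p' \<beta> = 0" if "paired G p p'" "poly p \<alpha> = 0" for p p'
    using that
  proof (induction "Polynomial.degree p" arbitrary: p p' rule: less_induct)
    case less
    show ?case
    proof (cases "p = 0")
      case True
      then show ?thesis using less.prems(1) paired_0 by (metis poly_0)
    next
      case False
      let ?n = "Polynomial.degree p"
      have le: "?k \<le> ?n" using min less False by blast
      \<comment> \<open>One step of pseudo-division: cross-multiplying by the leading coefficients
        cancels the top term without dividing, and the same operation on the images keeps q and q'
        paired.\<close>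
      define q where "q = monom (Polynomial.coeff m ?k) 0 * p - monom (Polynomial.coeff p ?n) (?n - ?k) * m"
      define q' where "q' = monom (Polynomial.coeff m' ?k) 0 * p' - monom (Polynomial.coeff p' ?n) (?n - ?k) * m'"
      have "paired G q q'" unfolding q_def q'_def
        using less.prems(1) m(1) by (intro paired_diff paired_mult paired_monom) (auto simp: paired_def)
      moreover have "poly q \<alpha> = 0" by (simp add: q_def less.prems m)
      moreover have "q = 0 \<or> Polynomial.degree q < ?n"
      proof -
        have "Polynomial.coeff q ?n = 0"
          using le by (simp add: q_def coeff_monom_mult)
        moreover have "Polynomial.degree q \<le> ?n"
          unfolding q_def
        proof (rule degree_diff_le)
          show "Polynomial.degree (monom (Polynomial.coeff m ?k) 0 * p) \<le> ?n"
            by (simp add: monom_0)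
          show "Polynomial.degree (monom (Polynomial.coeff p ?n) (?n - ?k) * m) \<le> ?n"
            using degree_mult_le[of "monom (Polynomial.coeff p ?n) (?n - ?k)" m]
              degree_monom_le[of "Polynomial.coeff p ?n" "?n - ?k"] le by linarith
        qed
        ultimately show ?thesis
          by (metis le_neq_implies_less leading_coeff_0_iff)
      qed
      ultimately have "poly q' \<beta> = 0" using less.hyps paired_0 by fastforce
      \<comment> \<open>At \<beta> the m' term vanishes, so q'(\<beta>) is p'(\<beta>) times the
        coefficient shown nonzero in \<open>lead\<close>.\<close>
      then show ?thesis using lead by (simp add: q'_def m poly_monom)
    qed
  qed
  show sub: "G \<subseteq> simple_ext G \<alpha> \<beta>"
  proof safe
    fix a b assume "(a, b) \<in> G"
    then have "paired G (monom a 0) (monom b 0)" by (rule paired_monom)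
    then show "(a, b) \<in> simple_ext G \<alpha> \<beta>" unfolding simple_ext_def
      by (intro CollectI exI[of _ "monom a 0"] exI[of _ "monom b 0"]) (simp add: poly_monom)
  qed
  have "paired G (monom 1 1) (monom 1 1)" using graph_hom_Rats[of 1] by (intro paired_monom) simp
  then show "(\<alpha>, \<beta>) \<in> simple_ext G \<alpha> \<beta>" unfolding simple_ext_def
    by (intro CollectI exI[of _ "monom 1 1"]) (simp add: poly_monom)
  show "graph_hom (simple_ext G \<alpha> \<beta>)"
    unfolding graph_hom_def
  proof (intro conjI allI impI ballI)
    have "poly p \<alpha> \<in> Qbar" if "paired G p p'" for p p'
      using that
    proof (induction p arbitrary: p')
      case 0
      show ?case using Rats_subset_Qbar by auto
    next
      case (pCons a p)
      obtain b q where p': "p' = pCons b q" by (rule pCons_cases)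
      have "(a, b) \<in> G" "paired G p q"
        using pCons.prems unfolding paired_def p' by (metis coeff_pCons_0, metis coeff_pCons_Suc)
      moreover have "a \<in> Qbar" using \<open>(a, b) \<in> G\<close> G by (auto simp: graph_hom_def)
      ultimately show ?case
        using pCons.IH \<alpha> by (simp add: Qbar_add Qbar_mult)
    qed
    then show "Domain (simple_ext G \<alpha> \<beta>) \<subseteq> Qbar" by (auto simp: simple_ext_def)
    show "(q, q) \<in> simple_ext G \<alpha> \<beta>" if "q \<in> \<rat>" for q
      using that sub graph_hom_Rats by blast
    show "u = 0" if "(0, u) \<in> simple_ext G \<alpha> \<beta>" for u
      using that zero by (auto simp: simple_ext_def)
    fix x u y v
    assume "(x, u) \<in> simple_ext G \<alpha> \<beta>" "(y, v) \<in> simple_ext G \<alpha> \<beta>"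
    then obtain p p' q q' where pq: "paired G p p'" "paired G q q'"
      "x = poly p \<alpha>" "u = poly p' \<beta>" "y = poly q \<alpha>" "v = poly q' \<beta>"
      by (auto simp: simple_ext_def)
    show "(x + y, u + v) \<in> simple_ext G \<alpha> \<beta>" unfolding simple_ext_def
      using pq paired_add[OF pq(1,2)] by (metis (mono_tags, lifting) mem_Collect_eq poly_add)
    show "(x * y, u * v) \<in> simple_ext G \<alpha> \<beta>" unfolding simple_ext_def
      using pq paired_mult[OF pq(1,2)] by (metis (mono_tags, lifting) mem_Collect_eq poly_mult)
  qed
qed

lemma ex_minimal_paired:
  assumes "\<alpha> \<in> Qbar"
  obtains m m' where "paired G m m'" "m \<noteq> 0" "poly m \<alpha> = 0"
    "\<And>p p'. paired G p p' \<Longrightarrow> p \<noteq> 0 \<Longrightarrow> poly p \<alpha> = 0 \<Longrightarrow>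
      Polynomial.degree m \<le> Polynomial.degree p"
proof -
  let ?P = "\<lambda>m. (\<exists>m'. paired G m m') \<and> m \<noteq> 0 \<and> poly m \<alpha> = 0"
  obtain p where "\<forall>i. Polynomial.coeff p i \<in> \<rat>" "p \<noteq> 0" "poly p \<alpha> = 0"
    using assms by (auto simp: Qbar_def algebraic_altdef)
  then have "?P p" using graph_hom_Rats by (auto simp: paired_def)
  then obtain m where "?P m" "\<forall>p. ?P p \<longrightarrow> Polynomial.degree m \<le> Polynomial.degree p"
    using ex_has_least_nat[of ?P p Polynomial.degree] by blast
  then show thesis using that by blast
qed

text \<open>The root \<beta> is taken in the complex numbers: \<open>graph_hom\<close> asks only the
  domain to be algebraic, and values turn out algebraic in
  \<open>Galois_group_of_graph_hom\<close>.\<close>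

lemma ex_graph_hom_extension:
  assumes "\<alpha> \<in> Qbar"
  obtains G' where "graph_hom G'" "G \<subseteq> G'" "\<alpha> \<in> Domain G'"
proof -
  obtain m m' where m: "paired G m m'" "m \<noteq> 0" "poly m \<alpha> = 0" and
    min: "\<And>p p'. paired G p p' \<Longrightarrow> p \<noteq> 0 \<Longrightarrow> poly p \<alpha> = 0 \<Longrightarrow>
      Polynomial.degree m \<le> Polynomial.degree p"
    using ex_minimal_paired[OF assms] by blast
  let ?k = "Polynomial.degree m"
  have "Polynomial.coeff m' ?k \<noteq> 0"
    using m(1,2) graph_hom_inj leading_coeff_0_iff unfolding paired_def by metis
  then have "?k \<le> Polynomial.degree m'" by (rule le_degree)
  moreover have "?k > 0"
    using m(2,3) by (metis degree_eq_zeroE gr0I poly_const_conv pCons_0_0)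
  ultimately obtain \<beta> where "poly m' \<beta> = 0"
    using alg_closed_imp_poly_has_root[of m'] by auto
  then show thesis
    using that[of "simple_ext G \<alpha> \<beta>"] graph_hom_simple_ext[OF assms m, of \<beta>] min
    by blast
qed

text \<open>This makes all values algebraic and confines the image of each element to a finite set
  of conjugates.\<close>

lemma graph_hom_algebraic:
  assumes "(x, u) \<in> G" "\<forall>i. Polynomial.coeff p i \<in> \<rat>" "poly p x = 0"
  shows "poly p u = 0"
proof -
  have "paired G p p" using assms(2) graph_hom_Rats by (simp add: paired_def)
  then show ?thesis using paired_poly[OF _ assms(1)] assms(3) graph_hom_0 by metis
qed

end

section \<open>Extension to all of \<open>Qbar\<close> by Zorn's lemma\<close>

lemma graph_hom_Union_chain:
  assumes "\<C> \<noteq> {}" "subset.chain (Collect graph_hom) \<C>"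
  shows "graph_hom (\<Union>\<C>)"
proof -
  have hom: "graph_hom G" if "G \<in> \<C>" for G
    using that assms(2) by (auto simp: subset.chain_def)
  \<comment> \<open>Each clause of \<open>graph_hom\<close> concerns at most two given pairs, so it
    is enough that any two pairs of the union lie in one member of the chain.\<close>
  have common: "\<exists>G\<in>\<C>. a \<in> G \<and> b \<in> G" if "a \<in> \<Union>\<C>" "b \<in> \<Union>\<C>" for a b
    using that assms(2) unfolding subset.chain_def by blast
  show ?thesis
    unfolding graph_hom_def
  proof (intro conjI allI impI ballI)
    show "Domain (\<Union>\<C>) \<subseteq> Qbar" using hom by (fastforce simp: graph_hom_def)
    show "(q, q) \<in> \<Union>\<C>" if "q \<in> \<rat>" for q
      using that assms(1) hom graph_hom_Rats by blast
    show "u = 0" if "(0, u) \<in> \<Union>\<C>" for u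
      using that hom graph_hom_0 by blast
    fix x u y v
    assume "(x, u) \<in> \<Union>\<C>" "(y, v) \<in> \<Union>\<C>"
    then obtain G where "G \<in> \<C>" "(x, u) \<in> G" "(y, v) \<in> G" using common by blast
    then show "(x + y, u + v) \<in> \<Union>\<C>" "(x * y, u * v) \<in> \<Union>\<C>"
      using hom graph_hom_add graph_hom_mult by blast+
  qed
qed

lemma ex_total_graph_hom:
  assumes "graph_hom G"
  obtains H where "graph_hom H" "G \<subseteq> H" "Domain H = Qbar"
proof -
  define \<A> where "\<A> = {H. graph_hom H \<and> G \<subseteq> H}"
  have "\<exists>M\<in>\<A>. \<forall>Y\<in>\<A>. M \<subseteq> Y \<longrightarrow> Y = M"
  proof (rule subset_Zorn_nonempty)
    show "\<A> \<noteq> {}" using assms by (auto simp: \<A>_def)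
    fix \<C> assume "\<C> \<noteq> {}" "subset.chain \<A> \<C>"
    then have sub: "\<C> \<subseteq> \<A>" "subset.chain (Collect graph_hom) \<C>"
      unfolding subset.chain_def \<A>_def by blast+
    have "graph_hom (\<Union>\<C>)" by (rule graph_hom_Union_chain[OF \<open>\<C> \<noteq> {}\<close> sub(2)])
    moreover have "G \<subseteq> \<Union>\<C>" using sub(1) \<open>\<C> \<noteq> {}\<close> unfolding \<A>_def by blast
    ultimately show "\<Union>\<C> \<in> \<A>" by (simp add: \<A>_def)
  qed
  then obtain H where "H \<in> \<A>" and max: "\<And>Y. Y \<in> \<A> \<Longrightarrow> H \<subseteq> Y \<Longrightarrow> Y = H"
    by blast
  then have H: "graph_hom H" "G \<subseteq> H" by (simp_all add: \<A>_def)
  have "\<alpha> \<in> Domain H" if "\<alpha> \<in> Qbar" for \<alpha>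
  proof -
    obtain H' where H': "graph_hom H'" "H \<subseteq> H'" "\<alpha> \<in> Domain H'"
      using ex_graph_hom_extension[OF H(1) \<open>\<alpha> \<in> Qbar\<close>] by blast
    then have "H' \<in> \<A>" using H(2) unfolding \<A>_def by blast
    then have "H' = H" using H'(2) by (rule max)
    then show ?thesis using H'(3) by simp
  qed
  then have "Domain H = Qbar" using H(1) by (auto simp: graph_hom_def)
  then show thesis using that H by blast
qed

lemma Galois_group_of_graph_hom:
  assumes H: "graph_hom H" and dom: "Domain H = Qbar"
  shows "\<exists>\<sigma>\<in>Galois_group. \<forall>x u. (x, u) \<in> H \<longrightarrow> \<sigma> x = u"
proof -
  define \<sigma> where "\<sigma> = restrict (\<lambda>x. THE u. (x, u) \<in> H) Qbar"
  have \<sigma>: "\<sigma> x = u" if "(x, u) \<in> H" for x u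
    using that dom graph_hom_functional[OF H] by (auto simp: \<sigma>_def)
  have graph: "(x, \<sigma> x) \<in> H" if "x \<in> Qbar" for x
    using that dom \<sigma> by blast
  have into: "\<sigma> x \<in> Qbar" if "x \<in> Qbar" for x
  proof -
    obtain p where "\<forall>i. Polynomial.coeff p i \<in> \<rat>" "p \<noteq> 0" "poly p x = 0"
      using \<open>x \<in> Qbar\<close> unfolding Qbar_def algebraic_altdef by blast
    then show ?thesis
      using graph_hom_algebraic[OF H graph[OF \<open>x \<in> Qbar\<close>]] unfolding Qbar_def algebraic_altdef
      by blast
  qed
  have inj: "inj_on \<sigma> Qbar"
  proof (rule inj_onI)
    fix x y assume "x \<in> Qbar" "y \<in> Qbar" "\<sigma> x = \<sigma> y"
    then have "(x - y, 0) \<in> H" using graph_hom_diff[OF H graph graph, of x y] by simp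
    then show "x = y" using graph_hom_inj[OF H, of "x - y"] by simp
  qed
  have "y \<in> \<sigma> ` Qbar" if "y \<in> Qbar" for y
  proof -
    obtain p where p: "\<forall>i. Polynomial.coeff p i \<in> \<rat>" "p \<noteq> 0" "poly p y = 0"
      using \<open>y \<in> Qbar\<close> unfolding Qbar_def algebraic_altdef by blast
    let ?S = "{z. poly p z = 0}"
    have S: "?S \<subseteq> Qbar" using p(1,2) unfolding Qbar_def algebraic_altdef by blast
    \<comment> \<open>Surjectivity without constructing an inverse: \<sigma> maps the finite root
      set of p injectively into itself, hence onto itself.\<close>
    have "\<sigma> ` ?S \<subseteq> ?S"
      using S graph graph_hom_algebraic[OF H _ p(1)] by blast
    then have "\<sigma> ` ?S = ?S"
      using endo_inj_surj[OF poly_roots_finite[OF p(2)]] inj_on_subset[OF inj S] by blast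
    then show ?thesis using S p(3) by blast
  qed
  then have "bij_betw \<sigma> Qbar Qbar" using inj into by (auto simp: bij_betw_def)
  then have "\<sigma> \<in> ring_iso Qbar_ring Qbar_ring"
    using into \<sigma>[OF graph_hom_add[OF H graph graph]] \<sigma>[OF graph_hom_mult[OF H graph graph]]
      \<sigma>[OF graph_hom_Rats[OF H]]
    by (auto simp: ring_iso_def ring_hom_def Qbar_ring_def ring_of_type_algebra_def)
  moreover have "\<sigma> \<in> extensional Qbar" by (simp add: \<sigma>_def)
  moreover have "\<forall>x\<in>\<rat>. \<sigma> x = x" using \<sigma> graph_hom_Rats[OF H] by blast
  ultimately have "\<sigma> \<in> Galois_group" by (simp add: Galois_group_def)
  then show ?thesis using \<sigma> by blast
qed

text \<open>A minimal polynomial of \<open>x\<close> has a root besides \<open>x\<close>, since otherwise its derivative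
  would be a shorter polynomial vanishing at \<open>x\<close>.\<close>

lemma Galois_group_moves:
  assumes "K \<subseteq> Qbar" "\<rat> \<subseteq> K"
    and add: "\<And>x y. x \<in> K \<Longrightarrow> y \<in> K \<Longrightarrow> x + y \<in> K"
    and mult: "\<And>x y. x \<in> K \<Longrightarrow> y \<in> K \<Longrightarrow> x * y \<in> K"
    and x: "x \<in> Qbar" "x \<notin> K"
  shows "\<exists>\<sigma>\<in>Galois_group. (\<forall>k\<in>K. \<sigma> k = k) \<and> \<sigma> x \<noteq> x"
proof -
  define G where "G = Id_on K"
  have G: "graph_hom G"
    using assms by (auto simp: graph_hom_def G_def)
  \<comment> \<open>For the identity on \<open>K\<close>, paired polynomials are equal, so
    \<open>paired G m m\<close> just says that m has coefficients in \<open>K\<close>.\<close>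
  have same: "p' = p" if "paired G p p'" for p p'
    using that by (auto simp: paired_def G_def poly_eq_iff)
  obtain m where m: "paired G m m" "m \<noteq> 0" "poly m x = 0" and
    min: "\<And>p. paired G p p \<Longrightarrow> p \<noteq> 0 \<Longrightarrow> poly p x = 0 \<Longrightarrow>
      Polynomial.degree m \<le> Polynomial.degree p"
  proof (rule ex_minimal_paired[OF G x(1)])
    fix m m'
    assume "paired G m m'" "m \<noteq> 0" "poly m x = 0" and min: "\<And>p p'. paired G p p' \<Longrightarrow> p \<noteq> 0 \<Longrightarrow>
      poly p x = 0 \<Longrightarrow> Polynomial.degree m \<le> Polynomial.degree p"
    moreover from this(1) have "m' = m" by (rule same)
    ultimately show thesis using that[of m] by blast
  qed
  have coeff: "Polynomial.coeff m i \<in> K" for i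
    using m(1) by (auto simp: paired_def G_def)
  have nz: "Polynomial.degree m \<noteq> 0"
    using m(2,3) by (metis degree_eq_zeroE poly_const_conv pCons_0_0)
  have "poly (pderiv m) x \<noteq> 0"
  proof
    assume "poly (pderiv m) x = 0"
    moreover have "Polynomial.coeff (pderiv m) i \<in> K" for i
      unfolding coeff_pderiv using assms(2) coeff by (intro mult) auto
    then have "paired G (pderiv m) (pderiv m)" by (simp add: paired_def G_def Id_onI)
    moreover have "pderiv m \<noteq> 0" using nz by (simp add: pderiv_eq_0_iff)
    ultimately have "Polynomial.degree m \<le> Polynomial.degree (pderiv m)" by (intro min)
    then show False using nz by (simp add: degree_pderiv)
  qed
  have "\<exists>y. y \<noteq> x \<and> poly m y = 0"
  proof -
    \<comment> \<open>Split off the root x once: the derivative of m at x equals r(x), which is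
      nonzero, so a root of r is a root of m other than x.\<close>
    obtain r where r: "m = [:- x, 1:] * r" using m(3) by (metis dvdE poly_eq_0_iff_dvd)
    have "pderiv m = [:- x, 1:] * pderiv r + r * pderiv [:- x, 1:]"
      unfolding r by (rule pderiv_mult)
    then have "poly (pderiv m) x = poly r x" by (simp add: pderiv_pCons)
    then have rx: "poly r x \<noteq> 0" using \<open>poly (pderiv m) x \<noteq> 0\<close> by simp
    \<comment> \<open>A constant r = c would give m = c (X - x) and put x, up to sign a quotient of
      coefficients of m, into \<open>K\<close>.\<close>
    have "Polynomial.degree r \<noteq> 0"
    proof
      assume "Polynomial.degree r = 0"
      then obtain c where c: "r = [:c:]" by (rule degree_eq_zeroE)
      have "c \<in> K" "- (x * c) \<in> K" "c \<noteq> 0"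
        using coeff[of 1] coeff[of 0] rx by (simp_all add: r c mult.commute)
      moreover from this have "inverse c \<in> K"
        using subring_inverse_closed[OF assms(1-4)] by blast
      moreover have "-1 \<in> K" using assms(2) by auto
      ultimately have "-1 * (- (x * c) * inverse c) \<in> K" using mult by blast
      then show False using x(2) \<open>c \<noteq> 0\<close> by (simp add: mult.assoc)
    qed
    then obtain y where "poly r y = 0" using alg_closed_imp_poly_has_root[of r] by auto
    then show ?thesis using rx by (auto simp: r)
  qed
  then obtain y where y: "y \<noteq> x" "poly m y = 0" by blast
  have min': "Polynomial.degree m \<le> Polynomial.degree p"
    if "paired G p p'" "p \<noteq> 0" "poly p x = 0" for p p'
    using min that same[OF that(1)] by simp
  have ext: "graph_hom (simple_ext G x y)" "G \<subseteq> simple_ext G x y" "(x, y) \<in> simple_ext G x y"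
    using graph_hom_simple_ext[OF G x(1) m y(2) min'] by simp_all
  obtain H where H: "graph_hom H" "simple_ext G x y \<subseteq> H" "Domain H = Qbar"
    by (rule ex_total_graph_hom[OF ext(1)])
  obtain \<sigma> where \<sigma>: "\<sigma> \<in> Galois_group" "\<And>x u. (x, u) \<in> H \<Longrightarrow> \<sigma> x = u"
    using Galois_group_of_graph_hom[OF H(1,3)] by metis
  show ?thesis
  proof (intro bexI[OF _ \<sigma>(1)] conjI ballI)
    show "\<sigma> k = k" if "k \<in> K" for k
      using that ext(2) H(2) by (intro \<sigma>(2)) (auto simp: G_def)
    have "\<sigma> x = y" using ext(3) H(2) by (intro \<sigma>(2)) blast
    then show "\<sigma> x \<noteq> x" using y(1) by simp
  qed
qed

section \<open>Moebius transformations and the Galois action on rational maps\<close>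

text \<open>Homogeneous coordinates [x : y] on the sphere. The pair (0, 0) is no point but gets the
  value \<open>None\<close>, whence the side conditions on pairs below.\<close>

definition hpoint :: "complex \<Rightarrow> complex \<Rightarrow> complex option" where
  "hpoint x y = (if y = 0 then None else Some (x / y))"

definition moeb :: "complex \<Rightarrow> complex \<Rightarrow> complex \<Rightarrow> complex \<Rightarrow> complex option \<Rightarrow> complex option" where
  "moeb a b c d = ratmap [:b, a:] [:d, c:]"

lemma hpoint_cases:
  obtains x y where "w = hpoint x y" "(x, y) \<noteq> (0, 0)"
proof (cases w)
  case None
  then show thesis using that[of 1 0] by (simp add: hpoint_def)
next
  case (Some z)
  then show thesis using that[of z 1] by (simp add: hpoint_def)
qed

lemma hpoint_eqI:
  assumes "(x, y) \<noteq> (0, 0)" "(x', y') \<noteq> (0, 0)" "x * y' = x' * y"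
  shows "hpoint x y = hpoint x' y'"
  using assms by (auto simp: hpoint_def field_simps)

lemma hpoint_eqD:
  assumes "hpoint x y = hpoint x' y'"
  shows "x * y' = x' * y"
  using assms by (auto simp: hpoint_def field_simps split: if_splits)

lemma hpoint_scale: "k \<noteq> 0 \<Longrightarrow> hpoint (k * x) (k * y) = hpoint x y"
  by (simp add: hpoint_def)

lemma ratmap_Some: "ratmap p q (Some z) = hpoint (poly p z) (poly q z)"
  by (simp add: ratmap_def hpoint_def)

lemma moeb_hpoint:
  assumes "a * d - b * c \<noteq> 0" "(x, y) \<noteq> (0, 0)"
  shows "moeb a b c d (hpoint x y) = hpoint (a * x + b * y) (c * x + d * y)"
proof (cases "y = 0")
  case True
  \<comment> \<open>A nonzero determinant excludes a = c = 0, so \<open>ratmap\<close> reads its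
    value at infinity in degree 1.\<close>
  have "max (Polynomial.degree [:b, a:]) (Polynomial.degree [:d, c:]) = 1" using assms(1) by auto
  then show ?thesis using True assms(2) by (simp add: hpoint_def moeb_def ratmap_def Let_def)
next
  case False
  have "moeb a b c d (hpoint x y) = hpoint (b + x / y * a) (d + x / y * c)"
    using False by (simp add: moeb_def hpoint_def[of x y] ratmap_Some)
  also have "\<dots> = hpoint (y * (b + x / y * a)) (y * (d + x / y * c))"
    using False by (simp add: hpoint_scale)
  finally show ?thesis using False by (simp add: algebra_simps)
qed

lemma linear_pair_nonzero:
  fixes a b c d x y :: complex
  assumes "a * d - b * c \<noteq> 0" "(x, y) \<noteq> (0, 0)"
  shows "(a * x + b * y, c * x + d * y) \<noteq> (0, 0)"
proof
  assume "(a * x + b * y, c * x + d * y) = (0, 0)"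
  \<comment> \<open>Applying the adjugate matrix recovers (x, y) up to the determinant.\<close>
  then have "d * (a * x + b * y) - b * (c * x + d * y) = 0"
    "a * (c * x + d * y) - c * (a * x + b * y) = 0" by simp_all
  then have "(a * d - b * c) * x = 0" "(a * d - b * c) * y = 0" by (simp_all add: algebra_simps)
  then show False using assms by simp
qed

lemma moeb_comp:
  assumes "a * d - b * c \<noteq> 0" "a' * d' - b' * c' \<noteq> 0"
  shows "moeb a b c d \<circ> moeb a' b' c' d' =
    moeb (a * a' + b * c') (a * b' + b * d') (c * a' + d * c') (c * b' + d * d')"
    and "(a * a' + b * c') * (c * b' + d * d') - (a * b' + b * d') * (c * a' + d * c') \<noteq> 0"
proof -
  have "(a * a' + b * c') * (c * b' + d * d') - (a * b' + b * d') * (c * a' + d * c')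
      = (a * d - b * c) * (a' * d' - b' * c')" by (simp add: algebra_simps)
  then show det: "(a * a' + b * c') * (c * b' + d * d') - (a * b' + b * d') * (c * a' + d * c') \<noteq> 0"
    using assms by simp
  show "moeb a b c d \<circ> moeb a' b' c' d' =
    moeb (a * a' + b * c') (a * b' + b * d') (c * a' + d * c') (c * b' + d * d')"
  proof
    fix w
    obtain x y where w: "w = hpoint x y" "(x, y) \<noteq> (0, 0)" by (rule hpoint_cases)
    show "(moeb a b c d \<circ> moeb a' b' c' d') w =
      moeb (a * a' + b * c') (a * b' + b * d') (c * a' + d * c') (c * b' + d * d') w"
      unfolding w(1) comp_apply moeb_hpoint[OF assms(2) w(2)] moeb_hpoint[OF det w(2)]
        moeb_hpoint[OF assms(1) linear_pair_nonzero[OF assms(2) w(2)]]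
      by (simp add: algebra_simps)
  qed
qed

lemma moeb_scalar: "k \<noteq> 0 \<Longrightarrow> moeb k 0 0 k = id"
proof
  fix w assume "k \<noteq> 0"
  obtain x y where "w = hpoint x y" "(x, y) \<noteq> (0, 0)" by (rule hpoint_cases)
  then show "moeb k 0 0 k w = id w" using \<open>k \<noteq> 0\<close> by (simp add: moeb_hpoint hpoint_scale)
qed

text \<open>The adjugate serves as inverse: both products are the determinant times the identity
  matrix, and scalar matrices act trivially.\<close>

lemma moeb_inverse:
  assumes "a * d - b * c \<noteq> 0"
  shows "moeb a b c d \<circ> moeb d (- b) (- c) a = id" "moeb d (- b) (- c) a \<circ> moeb a b c d = id"
proof -
  have det: "d * a - (- b) * (- c) \<noteq> 0" using assms by (simp add: mult.commute)
  show "moeb a b c d \<circ> moeb d (- b) (- c) a = id"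
    using moeb_comp(1)[OF assms det] moeb_scalar[OF assms] by (simp add: algebra_simps)
  show "moeb d (- b) (- c) a \<circ> moeb a b c d = id"
    using moeb_comp(1)[OF det assms] moeb_scalar[OF assms] by (simp add: algebra_simps)
qed

lemma bij_moeb:
  assumes "a * d - b * c \<noteq> 0"
  shows "bij (moeb a b c d)"
  using moeb_inverse[OF assms] by (rule o_bij[rotated])

lemma inv_moeb:
  assumes "a * d - b * c \<noteq> 0"
  shows "inv_into UNIV (moeb a b c d) = moeb d (- b) (- c) a"
  using moeb_inverse[OF assms] by (intro inv_unique_comp)

section \<open>The group of Moebius maps with algebraic coefficients, and conjugacy\<close>

lemma MoebiusE:
  assumes "M \<in> Moebius"
  obtains a b c d where "a \<in> Qbar" "b \<in> Qbar" "c \<in> Qbar" "d \<in> Qbar" "a * d - b * c \<noteq> 0"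
    "M = moeb a b c d"
  using assms unfolding Moebius_def moeb_def by blast

lemma moeb_in_Moebius:
  "a \<in> Qbar \<Longrightarrow> b \<in> Qbar \<Longrightarrow> c \<in> Qbar \<Longrightarrow> d \<in> Qbar \<Longrightarrow> a * d - b * c \<noteq> 0 \<Longrightarrow>
    moeb a b c d \<in> Moebius"
  unfolding Moebius_def moeb_def by blast

lemma Moebius_comp:
  assumes "M \<in> Moebius" "N \<in> Moebius"
  shows "M \<circ> N \<in> Moebius"
proof -
  obtain a b c d where M: "a \<in> Qbar" "b \<in> Qbar" "c \<in> Qbar" "d \<in> Qbar" "a * d - b * c \<noteq> 0"
    "M = moeb a b c d" using assms(1) by (rule MoebiusE)
  obtain a' b' c' d' where N: "a' \<in> Qbar" "b' \<in> Qbar" "c' \<in> Qbar" "d' \<in> Qbar"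
    "a' * d' - b' * c' \<noteq> 0" "N = moeb a' b' c' d'" using assms(2) by (rule MoebiusE)
  show ?thesis
    unfolding M(6) N(6) moeb_comp(1)[OF M(5) N(5)]
    by (rule moeb_in_Moebius[OF _ _ _ _ moeb_comp(2)[OF M(5) N(5)]]) (intro Qbar_add Qbar_mult M N)+
qed

lemma Moebius_bij: "M \<in> Moebius \<Longrightarrow> bij M"
  by (elim MoebiusE) (simp add: bij_moeb)

lemma Moebius_comp_inv:
  assumes "M \<in> Moebius"
  shows "inv_into UNIV M \<circ> M = id" "M \<circ> inv_into UNIV M = id"
  using Moebius_bij[OF assms] bij_is_inj[of M] bij_is_surj[of M] by (metis inv_o_cancel, metis surj_iff)

lemma Moebius_inv:
  assumes "M \<in> Moebius"
  shows "inv_into UNIV M \<in> Moebius"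
  using assms
proof (rule MoebiusE)
  fix a b c d
  assume "a \<in> Qbar" "b \<in> Qbar" "c \<in> Qbar" "d \<in> Qbar" "a * d - b * c \<noteq> 0" "M = moeb a b c d"
  then show ?thesis
    by (simp add: inv_moeb) (intro moeb_in_Moebius Qbar_uminus; simp add: mult.commute)
qed

text \<open>The intertwining form contains no inverse, so symmetry, transitivity and the Galois
  action reduce to compositions.\<close>

lemma rat_conj_iff:
  "(f, g) \<in> rat_conj n \<longleftrightarrow> f \<in> Rat n \<and> g \<in> Rat n \<and> (\<exists>M\<in>Moebius. g \<circ> M = M \<circ> f)"
proof -
  have "g = M \<circ> f \<circ> inv_into UNIV M \<longleftrightarrow> g \<circ> M = M \<circ> f" if "M \<in> Moebius" for M
    using Moebius_comp_inv[OF that] by (metis comp_assoc comp_id)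
  then show ?thesis unfolding rat_conj_def by auto
qed

lemma rat_conj_sym:
  assumes "(f, g) \<in> rat_conj n"
  shows "(g, f) \<in> rat_conj n"
proof -
  obtain M where M: "f \<in> Rat n" "g \<in> Rat n" "M \<in> Moebius" "g \<circ> M = M \<circ> f"
    using assms unfolding rat_conj_iff by blast
  have "f \<circ> inv_into UNIV M = inv_into UNIV M \<circ> g"
    using Moebius_comp_inv[OF M(3)] M(4) by (metis comp_assoc comp_id id_comp)
  then show ?thesis using M Moebius_inv[OF M(3)] unfolding rat_conj_iff by blast
qed

lemma rat_conj_trans:
  assumes "(f, g) \<in> rat_conj n" "(g, h) \<in> rat_conj n"
  shows "(f, h) \<in> rat_conj n"
proof -
  obtain M where M: "f \<in> Rat n" "M \<in> Moebius" "g \<circ> M = M \<circ> f"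
    using assms(1) unfolding rat_conj_iff by blast
  obtain N where N: "h \<in> Rat n" "N \<in> Moebius" "h \<circ> N = N \<circ> g"
    using assms(2) unfolding rat_conj_iff by blast
  have "h \<circ> (N \<circ> M) = (N \<circ> M) \<circ> f" using M(3) N(3) by (metis comp_assoc)
  then show ?thesis using M(1) N(1) Moebius_comp[OF N(2) M(2)] unfolding rat_conj_iff by blast
qed

lemma conj_class_eq:
  assumes "(f, g) \<in> rat_conj n"
  shows "conj_class n f = conj_class n g"
  unfolding conj_class_def
  by (blast intro: rat_conj_trans[OF assms] rat_conj_trans[OF rat_conj_sym[OF assms]])

section \<open>Action of an automorphism on polynomials and rational maps\<close>

lemma over_Qbar_pCons: "over_Qbar (pCons a p) \<longleftrightarrow> a \<in> Qbar \<and> over_Qbar p"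
  unfolding over_Qbar_def by (metis coeff_pCons_0 coeff_pCons_Suc not0_implies_Suc)

lemma poly_in_Qbar: "over_Qbar p \<Longrightarrow> z \<in> Qbar \<Longrightarrow> poly p z \<in> Qbar"
proof (induction p)
  case 0
  show ?case using Rats_subset_Qbar by auto
next
  case (pCons a p)
  then show ?case by (simp add: over_Qbar_pCons Qbar_add Qbar_mult)
qed

lemma over_Qbar_pderiv: "over_Qbar p \<Longrightarrow> over_Qbar (pderiv p)"
  unfolding over_Qbar_def coeff_pderiv using Rats_subset_Qbar by (intro allI Qbar_mult) auto

context
  fixes \<sigma>
  assumes \<sigma>: "\<sigma> \<in> Galois_group"
begin

lemma Galois_add: "x \<in> Qbar \<Longrightarrow> y \<in> Qbar \<Longrightarrow> \<sigma> (x + y) = \<sigma> x + \<sigma> y"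
  using \<sigma> by (auto simp: Galois_group_def ring_iso_def ring_hom_def Qbar_ring_def ring_of_type_algebra_def)

lemma Galois_Rats: "x \<in> \<rat> \<Longrightarrow> \<sigma> x = x"
  using \<sigma> by (simp add: Galois_group_def)

lemma Galois_bij: "bij_betw \<sigma> Qbar Qbar"
  using \<sigma> by (simp add: Galois_group_def ring_iso_def Qbar_ring_def)

lemma Galois_closed: "x \<in> Qbar \<Longrightarrow> \<sigma> x \<in> Qbar"
  using Galois_bij by (rule bij_betw_apply)

lemma Galois_eq_0_iff: "x \<in> Qbar \<Longrightarrow> \<sigma> x = 0 \<longleftrightarrow> x = 0"
  using Galois_group_nonzero[OF \<sigma>] Galois_group_0[OF \<sigma>] by auto

lemma Galois_uminus: "x \<in> Qbar \<Longrightarrow> \<sigma> (- x) = - \<sigma> x"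
  using Galois_add[of x "- x"] by (simp add: Qbar_uminus Galois_group_0[OF \<sigma>] eq_neg_iff_add_eq_0 add.commute)

lemma Galois_inverse:
  assumes "x \<in> Qbar"
  shows "\<sigma> (inverse x) = inverse (\<sigma> x)"
proof (cases "x = 0")
  case True
  then show ?thesis by (simp add: Galois_group_0[OF \<sigma>])
next
  case False
  have "\<sigma> (x * inverse x) = \<sigma> x * \<sigma> (inverse x)"
    by (rule Galois_group_mult[OF \<sigma> assms Qbar_inverse[OF assms]])
  then have "\<sigma> x * \<sigma> (inverse x) = 1" using False Galois_Rats[of 1] by simp
  then show ?thesis by (metis inverse_unique)
qed

lemma Galois_divide: "x \<in> Qbar \<Longrightarrow> y \<in> Qbar \<Longrightarrow> \<sigma> (x / y) = \<sigma> x / \<sigma> y"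
  by (simp add: divide_inverse Galois_group_mult[OF \<sigma>] Galois_inverse Qbar_inverse)

lemma Galois_surjE:
  assumes "y \<in> Qbar"
  obtains x where "x \<in> Qbar" "y = \<sigma> x"
  using assms Galois_bij by (metis bij_betw_imp_surj_on imageE)

lemma over_Qbar_map_poly: "over_Qbar p \<Longrightarrow> over_Qbar (map_poly \<sigma> p)"
  by (simp add: over_Qbar_def coeff_map_poly Galois_group_0[OF \<sigma>] Galois_closed)

lemma poly_map_poly_Galois:
  "over_Qbar p \<Longrightarrow> z \<in> Qbar \<Longrightarrow> poly (map_poly \<sigma> p) (\<sigma> z) = \<sigma> (poly p z)"
proof (induction p)
  case 0
  show ?case by (simp add: Galois_group_0[OF \<sigma>])
next
  case (pCons a p)
  then show ?case
    by (simp add: over_Qbar_pCons map_poly_pCons Galois_group_0[OF \<sigma>] Galois_add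
        Galois_group_mult[OF \<sigma>] Qbar_mult poly_in_Qbar)
qed

lemma degree_map_poly_Galois: "over_Qbar p \<Longrightarrow> Polynomial.degree (map_poly \<sigma> p) = Polynomial.degree p"
  by (cases "p = 0") (auto intro!: map_poly_degree_eq simp: Galois_eq_0_iff over_Qbar_def)

lemma pderiv_map_poly_Galois:
  assumes "over_Qbar p"
  shows "pderiv (map_poly \<sigma> p) = map_poly \<sigma> (pderiv p)"
proof (rule poly_eqI)
  fix i
  have "of_nat (Suc i) \<in> Qbar" using Rats_subset_Qbar by auto
  then show "Polynomial.coeff (pderiv (map_poly \<sigma> p)) i = Polynomial.coeff (map_poly \<sigma> (pderiv p)) i"
    using assms Galois_Rats[of "of_nat (Suc i)"]
    by (simp add: coeff_pderiv coeff_map_poly Galois_group_0[OF \<sigma>] Galois_group_mult[OF \<sigma>] over_Qbar_def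
        del: of_nat_Suc)
qed

lemma map_poly_Galois_eq_0_iff: "over_Qbar p \<Longrightarrow> map_poly \<sigma> p = 0 \<longleftrightarrow> p = 0"
  by (auto simp: poly_eq_iff coeff_map_poly Galois_group_0[OF \<sigma>] Galois_eq_0_iff over_Qbar_def)

text \<open>The root w is algebraic by \<open>root_in_Qbar\<close>, hence in the range of \<sigma>.
  This is how roots of an image polynomial are pulled back.\<close>

lemma map_poly_Galois_rootE:
  assumes "over_Qbar p" "p \<noteq> 0" "poly (map_poly \<sigma> p) w = 0"
  obtains z where "z \<in> Qbar" "w = \<sigma> z" "poly p z = 0"
proof -
  have "w \<in> Qbar"
    using assms by (intro root_in_Qbar[of "map_poly \<sigma> p"]) (simp_all add: over_Qbar_map_poly map_poly_Galois_eq_0_iff)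
  then obtain z where z: "z \<in> Qbar" "w = \<sigma> z" by (rule Galois_surjE)
  then have "poly p z = 0"
    using assms poly_map_poly_Galois[of p z] by (simp add: Galois_eq_0_iff poly_in_Qbar)
  then show thesis using that z by blast
qed

text \<open>A common nonconstant factor of the images has a root, which pulls back to a common root
  of p and q.\<close>

lemma coprime_map_poly_Galois:
  assumes "over_Qbar p" "over_Qbar q" "coprime p q"
  shows "coprime (map_poly \<sigma> p) (map_poly \<sigma> q)"
proof (rule ccontr)
  assume "\<not> ?thesis"
  then obtain h where h: "h dvd map_poly \<sigma> p" "h dvd map_poly \<sigma> q" "\<not> is_unit h"
    by (auto simp: coprime_def)
  have ne: "p \<noteq> 0 \<or> q \<noteq> 0" using assms(3) by auto
  then have "h \<noteq> 0" using h(1,2) assms by (auto simp: map_poly_Galois_eq_0_iff)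
  then have "Polynomial.degree h \<noteq> 0" using h(3) is_unit_iff_degree by blast
  then obtain w where "poly h w = 0" using alg_closed_imp_poly_has_root[of h] by auto
  then have w: "poly (map_poly \<sigma> p) w = 0" "poly (map_poly \<sigma> q) w = 0"
    using h(1,2) by (auto elim!: dvdE)
  obtain z where z: "z \<in> Qbar" "w = \<sigma> z"
    using ne w assms map_poly_Galois_rootE by metis
  then have "poly p z = 0" "poly q z = 0"
    using w assms poly_map_poly_Galois[of _ z] by (simp_all add: Galois_eq_0_iff poly_in_Qbar)
  then show False using coprime_poly_0[OF assms(3)] by blast
qed

lemma gal_rat_in_Rat:
  assumes "g \<in> Rat n"
  shows "gal_rat \<sigma> g \<in> Rat n"
proof -
  obtain p q where pq: "over_Qbar p" "over_Qbar q" "coprime p q" "g = ratmap p q"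
    "max (Polynomial.degree p) (Polynomial.degree q) = n"
    using assms unfolding Rat_def by blast
  show ?thesis
    unfolding pq(4) gal_rat_ratmap[OF \<sigma> pq(1-3)] Rat_def
    by (intro CollectI exI[of _ "map_poly \<sigma> p"] exI[of _ "map_poly \<sigma> q"])
      (simp add: pq over_Qbar_map_poly coprime_map_poly_Galois degree_map_poly_Galois)
qed

text \<open>Equivariance is restricted to infinity and the algebraic points, where \<sigma> acts. At
  infinity it relies on degrees being preserved, so that both sides read the same
  coefficients.\<close>

lemma ratmap_Galois:
  assumes "over_Qbar p" "over_Qbar q" "set_option w \<subseteq> Qbar"
  shows "ratmap (map_poly \<sigma> p) (map_poly \<sigma> q) (map_option \<sigma> w) = map_option \<sigma> (ratmap p q w)"
    and "set_option (ratmap p q w) \<subseteq> Qbar"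
proof -
  have c: "Polynomial.coeff p i \<in> Qbar" "Polynomial.coeff q i \<in> Qbar" for i
    using assms by (simp_all add: over_Qbar_def)
  show "ratmap (map_poly \<sigma> p) (map_poly \<sigma> q) (map_option \<sigma> w) = map_option \<sigma> (ratmap p q w)"
    using assms c
    by (cases w) (auto simp: ratmap_def Let_def degree_map_poly_Galois coeff_map_poly
        Galois_group_0[OF \<sigma>] Galois_eq_0_iff Galois_divide poly_map_poly_Galois poly_in_Qbar)
  show "set_option (ratmap p q w) \<subseteq> Qbar"
    using assms c by (cases w) (auto simp: ratmap_def Let_def Qbar_divide poly_in_Qbar)
qed

end

text \<open>P is the homogenisation of p in degree n, evaluated at (r, s). The degree is left free
  so that numerator and denominator can share one power of s.\<close>

lemma homogenize:
  fixes p r s :: "complex poly"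
  assumes "Polynomial.degree p \<le> n"
  shows "\<exists>P. \<forall>z. poly s z \<noteq> 0 \<longrightarrow> poly P z = poly s z ^ n * poly p (poly r z / poly s z)"
proof (intro exI allI impI)
  let ?P = "\<Sum>i\<le>n. smult (Polynomial.coeff p i) (r ^ i * s ^ (n - i))"
  fix z assume s: "poly s z \<noteq> 0"
  have "poly p x = (\<Sum>i\<le>n. Polynomial.coeff p i * x ^ i)" for x
    unfolding poly_altdef using assms
    by (intro sum.mono_neutral_left) (auto simp: coeff_eq_0)
  then have "poly s z ^ n * poly p (poly r z / poly s z)
      = (\<Sum>i\<le>n. poly s z ^ n * (Polynomial.coeff p i * (poly r z / poly s z) ^ i))"
    by (simp add: sum_distrib_left)
  also have "\<dots> = (\<Sum>i\<le>n. Polynomial.coeff p i * (poly r z ^ i * poly s z ^ (n - i)))"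
    using s by (intro sum.cong) (auto simp: power_divide power_diff)
  finally show "poly ?P z = poly s z ^ n * poly p (poly r z / poly s z)"
    by (simp add: poly_sum)
qed

lemma infinite_Qbar: "infinite Qbar"
  using infinite_super[of "\<nat>" Qbar] Rats_subset_Qbar Nats_infinite Nats_subset_Rats by blast

text \<open>Clearing denominators turns the conjugacy relation into a polynomial identity, so it extends
  from the infinite set \<open>Qbar\<close> to all points.\<close>

lemma conj_relation_extends:
  assumes cop: "coprime p q" and det: "a * d - b * c \<noteq> 0"
    and Qbar: "\<And>z. z \<in> Qbar \<Longrightarrow> ratmap p q (moeb a b c d (Some z)) = moeb a b c d (Some (poly f z))"
    and z: "c * z + d \<noteq> 0"
  shows "ratmap p q (moeb a b c d (Some z)) = moeb a b c d (Some (poly f z))"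
proof -
  let ?u = "\<lambda>z. (a * z + b) / (c * z + d)"
  have moeb_Some: "moeb a b c d (Some z) = hpoint (a * z + b) (c * z + d)" for z
    using moeb_hpoint[OF det, of z 1] by (simp add: hpoint_def)
  have lhs: "ratmap p q (moeb a b c d (Some z)) = hpoint (poly p (?u z)) (poly q (?u z))"
    if "c * z + d \<noteq> 0" for z
    using that by (simp add: moeb_Some hpoint_def[of "a * z + b"] ratmap_Some)
  let ?n = "max (Polynomial.degree p) (Polynomial.degree q)"
  obtain P where P: "\<And>z. poly [:d, c:] z \<noteq> 0 \<Longrightarrow>
      poly P z = poly [:d, c:] z ^ ?n * poly p (poly [:b, a:] z / poly [:d, c:] z)"
    using homogenize[of p ?n "[:d, c:]" "[:b, a:]"] by (metis max.cobounded1)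
  obtain Q where Q: "\<And>z. poly [:d, c:] z \<noteq> 0 \<Longrightarrow>
      poly Q z = poly [:d, c:] z ^ ?n * poly q (poly [:b, a:] z / poly [:d, c:] z)"
    using homogenize[of q ?n "[:d, c:]" "[:b, a:]"] by (metis max.cobounded2)
  \<comment> \<open>The difference of the two sides after cross-multiplying and clearing
    denominators.\<close>
  define R where "R = P * (smult c f + [:d:]) - (smult a f + [:b:]) * Q"
  have R: "poly R z = (c * z + d) ^ ?n *
      (poly p (?u z) * (c * poly f z + d) - (a * poly f z + b) * poly q (?u z))"
    if "c * z + d \<noteq> 0" for z
    using P[of z] Q[of z] that by (simp add: R_def algebra_simps)
  have "poly (R * [:d, c:]) z = 0" if "z \<in> Qbar" for z
  proof (cases "c * z + d = 0")
    case True
    then have "poly [:d, c:] z = 0" by (simp add: algebra_simps)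
    then show ?thesis by (simp only: poly_mult mult_zero_right)
  next
    case False
    have "hpoint (poly p (?u z)) (poly q (?u z)) = hpoint (a * poly f z + b) (c * poly f z + d)"
      using Qbar[OF that] unfolding lhs[OF False] unfolding moeb_Some .
    from hpoint_eqD[OF this] show ?thesis by (simp add: R[OF False])
  qed
  then have "Qbar \<subseteq> {z. poly (R * [:d, c:]) z = 0}" by blast
  then have "R * [:d, c:] = 0"
    using infinite_Qbar poly_roots_finite finite_subset by blast
  moreover have "[:d, c:] \<noteq> 0" using det by auto
  ultimately have "R = 0" by (metis mult_eq_0_iff)
  then have "poly p (?u z) * (c * poly f z + d) = (a * poly f z + b) * poly q (?u z)"
    using R[OF z] z by simp
  \<comment> \<open>Equal cross products mean equal points because neither pair is (0, 0): the first
    by coprimality, the second by the determinant.\<close>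
  then show ?thesis
    unfolding lhs[OF z] unfolding moeb_Some
    using coprime_poly_0[OF cop] linear_pair_nonzero[OF det, of "poly f z" 1]
    by (intro hpoint_eqI) auto
qed

section \<open>Rigidity of maps with critical values in zero and one\<close>

text \<open>Everything is expressed by values of f and its derivatives because
  \<open>map_poly\<close> transports these; the last clause encodes local degree exactly 2 over
  1.\<close>

definition crit_01 :: "complex poly \<Rightarrow> bool" where
  "crit_01 f \<longleftrightarrow> Polynomial.degree f \<ge> 3 \<and>
     (\<forall>z. poly (pderiv f) z = 0 \<longrightarrow> poly f z \<in> {0, 1}) \<and>
     (\<forall>z. poly f z = 1 \<longrightarrow> poly (pderiv f) z = 0 \<and> poly (pderiv (pderiv f)) z \<noteq> 0)"

lemma degree_eq_sum_order:
  fixes p :: "complex poly"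
  assumes "p \<noteq> 0"
  shows "Polynomial.degree p = (\<Sum>z | poly p z = 0. Polynomial.order z p)"
  using assms size_proots_complex[of p] by (simp add: size_multiset_overloaded_eq)

lemma order_eq_2:
  fixes p :: "complex poly"
  assumes "poly p z = 0" "poly (pderiv p) z = 0" "poly (pderiv (pderiv p)) z \<noteq> 0"
  shows "Polynomial.order z p = 2"
proof -
  have nz: "pderiv (pderiv p) \<noteq> 0" "pderiv p \<noteq> 0" "p \<noteq> 0" using assms(3) by auto
  have "Polynomial.order z p = Suc (Polynomial.order z (pderiv p))"
    by (rule order_pderiv[OF nz(3) assms(1)])
  also have "Polynomial.order z (pderiv p) = Suc (Polynomial.order z (pderiv (pderiv p)))"
    by (rule order_pderiv[OF nz(2) assms(2)])
  also have "Polynomial.order z (pderiv (pderiv p)) = 0"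
    using assms(3) by (rule order_0I)
  finally show ?thesis by simp
qed

lemma order_2_imp:
  fixes p :: "complex poly"
  assumes "Polynomial.order z p = 2" "pderiv p \<noteq> 0"
  shows "poly (pderiv p) z = 0" "poly (pderiv (pderiv p)) z \<noteq> 0"
proof -
  have "p \<noteq> 0" using assms(2) by auto
  moreover from this have "poly p z = 0" using assms(1) order_root[of p z] by simp
  ultimately have 1: "Polynomial.order z (pderiv p) = 1"
    using order_pderiv[of p z] assms(1) by simp
  then show 2: "poly (pderiv p) z = 0" using order_root[of "pderiv p" z] by simp
  have "pderiv (pderiv p) \<noteq> 0"
  proof
    assume "pderiv (pderiv p) = 0"
    then have "Polynomial.degree (pderiv p) = 0" by (simp add: pderiv_eq_0_iff)
    then obtain c where "pderiv p = [:c:]" by (rule degree_eq_zeroE)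
    then show False using 2 assms(2) by simp
  qed
  moreover from this have "Polynomial.order z (pderiv (pderiv p)) = 0"
    using order_pderiv[OF assms(2) 2] 1 by simp
  ultimately show "poly (pderiv (pderiv p)) z \<noteq> 0" using order_root by blast
qed

lemma card_double_roots:
  fixes p :: "complex poly"
  assumes "p \<noteq> 0" "\<And>z. poly p z = 0 \<Longrightarrow> poly (pderiv p) z = 0 \<and> poly (pderiv (pderiv p)) z \<noteq> 0"
  shows "Polynomial.degree p = 2 * card {z. poly p z = 0}"
  using degree_eq_sum_order[OF assms(1)] assms(2) by (simp add: order_eq_2)

lemma pderiv_diff_const: "pderiv (f - [:c:]) = pderiv (f :: complex poly)"
  by (simp add: pderiv_diff pderiv_pCons)

lemma degree_diff_const: "Polynomial.degree (f - [:c:]) = Polynomial.degree (f :: complex poly)"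
  by (cases f) simp

lemma DBP_crit_01:
  assumes "f \<in> DBP"
  shows "crit_01 f"
proof -
  have deg: "Polynomial.degree f \<ge> 3" using assms by (simp add: DBP_def)
  then have nz: "pderiv f \<noteq> 0" by (auto simp: pderiv_eq_0_iff)
  have "poly (pderiv f) z = 0 \<and> poly (pderiv (pderiv f)) z \<noteq> 0" if "poly f z = 1" for z
  proof -
    have "Polynomial.order z (f - [:1:]) = 2"
      using assms that by (auto simp: DBP_def local_degree_def)
    then show ?thesis using order_2_imp[of z "f - [:1:]"] nz by (simp add: pderiv_diff_const)
  qed
  moreover have "poly f z \<in> {0, 1}" if "poly (pderiv f) z = 0" for z
    using that assms by (auto simp: DBP_def critical_points_def)
  ultimately show ?thesis using deg unfolding crit_01_def by blast
qed

lemma crit_01_value_1: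
  assumes "crit_01 f"
  obtains z where "poly f z = 1" "poly (pderiv f) z = 0"
proof -
  have "Polynomial.degree (f - [:1:]) \<noteq> 0"
    using assms by (simp add: crit_01_def degree_diff_const)
  then obtain z where "poly (f - [:1:]) z = 0" using alg_closed_imp_poly_has_root[of "f - [:1:]"] by auto
  then show thesis using that assms by (simp add: crit_01_def)
qed

lemma crit_01_degree:
  assumes "crit_01 f"
  shows "Polynomial.degree f = 2 * card {z. poly f z = 1}"
proof -
  have deg: "Polynomial.degree (f - [:1:]) = Polynomial.degree f"
    using assms by (simp add: crit_01_def degree_diff_const)
  then have "f - [:1:] \<noteq> 0" using assms by (auto simp: crit_01_def)
  then show ?thesis
    using card_double_roots[of "f - [:1:]"] assms deg by (simp add: pderiv_diff_const crit_01_def)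
qed

lemma crit_01_value_0:
  assumes f: "crit_01 f"
  obtains z where "poly f z = 0" "poly (pderiv f) z = 0"
proof (rule ccontr)
  assume "\<not> thesis"
  then have one: "poly f z = 1" if "poly (pderiv f) z = 0" for z
    using that assms \<open>\<And>z. poly f z = 0 \<Longrightarrow> poly (pderiv f) z = 0 \<Longrightarrow> thesis\<close>
    by (auto simp: crit_01_def)
  have nz: "pderiv f \<noteq> 0" using f by (auto simp: crit_01_def pderiv_eq_0_iff)
  \<comment> \<open>Every critical point now lies over 1, where the second derivative is nonzero, so
    it is a simple zero of f'.\<close>
  have ord: "Polynomial.order z (pderiv f) = 1" if "poly (pderiv f) z = 0" for z
  proof -
    have "poly (pderiv (pderiv f)) z \<noteq> 0" using f one[OF that] by (simp add: crit_01_def)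
    moreover from this have "pderiv (pderiv f) \<noteq> 0" by auto
    ultimately show ?thesis
      using order_pderiv[OF nz that] order_0I[of "pderiv (pderiv f)" z] by simp
  qed
  have fin: "finite {z. poly f z = 1}"
    using crit_01_degree[OF f] f by (intro card_ge_0_finite) (auto simp: crit_01_def)
  have "Polynomial.degree (pderiv f) = card {z. poly (pderiv f) z = 0}"
    using degree_eq_sum_order[OF nz] ord by simp
  also have "\<dots> \<le> card {z. poly f z = 1}" using fin one by (intro card_mono) auto
  finally have "Polynomial.degree f - 1 \<le> card {z. poly f z = 1}" by (simp add: degree_pderiv)
  moreover have "Polynomial.degree f \<ge> 3" using f by (simp add: crit_01_def)
  ultimately show False using crit_01_degree[OF f] by linarith
qed

text \<open>The other possibility, an affine map exchanging \<open>0\<close> and \<open>1\<close>, would force all preimages of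
  both \<open>0\<close> and \<open>1\<close> to be double, which are more critical points than the degree allows.\<close>

lemma crit_01_affine_conj:
  assumes f: "crit_01 f" and g: "crit_01 g" and A: "A \<noteq> 0"
    and conj: "\<And>z. poly g (A * z + B) = A * poly f z + B"
  shows "g = f"
proof -
  \<comment> \<open>The conjugacy as a polynomial identity, to be differentiated. The factor A from
    the chain rule cancels, so critical points of f go to critical points of g.\<close>
  have "pcompose g [:B, A:] = smult A f + [:B:]"
    by (simp add: poly_eq_poly_eq_iff[symmetric] fun_eq_iff poly_pcompose conj[symmetric] algebra_simps)
      (metis add.commute conj mult.commute)
  then have "smult A (pcompose (pderiv g) [:B, A:]) = smult A (pderiv f)"
    using pderiv_pcompose[of g "[:B, A:]"] by (simp add: pderiv_add pderiv_smult pderiv_pCons)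
  then have pc: "pcompose (pderiv g) [:B, A:] = pderiv f" using A smult_cancel by blast
  then have d: "poly (pderiv g) (A * z + B) = poly (pderiv f) z" for z
  proof -
    have "poly (pcompose (pderiv g) [:B, A:]) z = poly (pderiv f) z" by (simp only: pc)
    then show ?thesis by (simp add: poly_pcompose add.commute mult.commute)
  qed
  have crit: "A * poly f z + B \<in> {0, 1}" if "poly (pderiv f) z = 0" for z
  proof -
    have "poly (pderiv g) (A * z + B) = 0" using that by (simp only: d)
    then have "poly g (A * z + B) \<in> {0, 1}" using g unfolding crit_01_def by blast
    then show ?thesis by (simp only: conj)
  qed
  obtain z0 where "poly f z0 = 0" "poly (pderiv f) z0 = 0" by (rule crit_01_value_0[OF f])
  then have B: "B \<in> {0, 1}" using crit[of z0] by simp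
  obtain z1 where "poly f z1 = 1" "poly (pderiv f) z1 = 0" by (rule crit_01_value_1[OF f])
  then have AB: "A + B \<in> {0, 1}" using crit[of z1] by simp
  show "g = f"
  proof (cases "B = 0")
    case True
    then have "A = 1" using AB A by auto
    then show ?thesis using conj True by (simp add: poly_eq_poly_eq_iff[symmetric] fun_eq_iff)
  next
    case False
    then have "B = 1" "A = -1" using A B AB by (auto simp: add_eq_0_iff2)
    then have d': "poly (pderiv g) (1 - z) = poly (pderiv f) z"
      and c: "poly g (1 - z) = 1 - poly f z" for z
      using d conj by (simp_all add: algebra_simps)
    \<comment> \<open>Here g(1 - z) = 1, and a point over 1 is critical for g, so z is critical for
      f.\<close>
    have 0: "poly (pderiv f) z = 0" if "poly f z = 0" for z
      using that c[of z] d'[of z] g by (simp add: crit_01_def)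
    have nz: "pderiv f \<noteq> 0" using f by (auto simp: crit_01_def pderiv_eq_0_iff)
    have card0: "card {z. poly f z = 0} = card {z. poly g z = 1}"
    proof (rule bij_betw_same_card, rule bij_betw_byWitness)
      show "(\<lambda>z. 1 - z) ` {z. poly f z = 0} \<subseteq> {z. poly g z = 1}"
        by (auto simp: c)
      show "(\<lambda>z. 1 - z) ` {z. poly g z = 1} \<subseteq> {z. poly f z = 0}"
      proof (intro image_subsetI CollectI)
        fix z assume "z \<in> {z. poly g z = 1}"
        then show "poly f (1 - z) = 0" using c[of "1 - z"] by simp
      qed
    qed simp_all
    have "Polynomial.degree g = Polynomial.degree f"
    proof -
      \<comment> \<open>Degrees are compared through derivatives; the lower bound 3 on both makes
        the truncated subtraction harmless.\<close>
      have "Polynomial.degree g - 1 = Polynomial.degree f - 1"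
        using arg_cong[OF pc, of Polynomial.degree] A by (simp add: degree_pcompose degree_pderiv)
      moreover have "Polynomial.degree f \<ge> 3" "Polynomial.degree g \<ge> 3"
        using f g by (simp_all add: crit_01_def)
      ultimately show ?thesis by linarith
    qed
    then have "card {z. poly f z = 0} + card {z. poly f z = 1} = Polynomial.degree f"
      using card0 crit_01_degree[OF f] crit_01_degree[OF g] by simp
    moreover have "card {z. poly f z = 0} + card {z. poly f z = 1}
        = card ({z. poly f z = 0} \<union> {z. poly f z = 1})"
      using card0 crit_01_degree[OF f] crit_01_degree[OF g] f g
      by (intro card_Un_disjoint[symmetric] card_ge_0_finite) (auto simp: crit_01_def)
    moreover have "\<dots> \<le> card {z. poly (pderiv f) z = 0}"
      using 0 f poly_roots_finite[OF nz] by (intro card_mono) (auto simp: crit_01_def)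
    moreover have "\<dots> \<le> Polynomial.degree (pderiv f)" by (rule card_poly_roots_bound[OF nz])
    moreover have "Polynomial.degree f \<ge> 3" using f by (simp add: crit_01_def)
    ultimately have False by (simp only: degree_pderiv)
    then show ?thesis ..
  qed
qed

lemma crit_01_no_exceptional_point:
  assumes f: "crit_01 f"
  shows "\<exists>z. z \<noteq> e \<and> poly f z = e"
proof (rule ccontr)
  assume "\<not> ?thesis"
  then have only: "poly f z = e \<Longrightarrow> z = e" for z by blast
  let ?p = "f - [:e:]"
  have deg: "Polynomial.degree ?p = Polynomial.degree f"
    using f by (simp add: crit_01_def degree_diff_const)
  then have nz: "?p \<noteq> 0" using f by (auto simp: crit_01_def)
  have nz': "pderiv f \<noteq> 0" using f by (auto simp: crit_01_def pderiv_eq_0_iff)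
  obtain z where "poly ?p z = 0" using alg_closed_imp_poly_has_root[of ?p] deg f by (auto simp: crit_01_def)
  then have "poly f z = e" by simp
  then have e: "poly f e = e" using only by metis
  \<comment> \<open>A single root carries the full degree as its multiplicity; this stands in for
    the normal form e + c (z - e)^n.\<close>
  have "{z. poly ?p z = 0} = {e}" using only e by auto
  then have ord: "Polynomial.order e ?p = Polynomial.degree f"
    using degree_eq_sum_order[OF nz] deg by simp
  then have ord': "Polynomial.order e (pderiv f) = Polynomial.degree f - 1"
    using order_pderiv[OF nz, of e] e by (simp add: pderiv_diff_const)
  obtain z where z: "poly f z = 1" "poly (pderiv f) z = 0" by (rule crit_01_value_1[OF f])
  \<comment> \<open>The multiplicity of e exhausts the degree of f', leaving no room for a second
    critical point.\<close>
  have "z = e"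
  proof (rule ccontr)
    assume "z \<noteq> e"
    have "Polynomial.order z (pderiv f) + Polynomial.order e (pderiv f)
        = (\<Sum>x\<in>{z, e}. Polynomial.order x (pderiv f))" using \<open>z \<noteq> e\<close> by simp
    also have "\<dots> \<le> (\<Sum>x | poly (pderiv f) x = 0. Polynomial.order x (pderiv f))"
      using z(2) ord' f nz' order_root[of "pderiv f" e] poly_roots_finite[OF nz']
      by (intro sum_mono2) (auto simp: crit_01_def)
    also have "\<dots> = Polynomial.degree f - 1"
      using degree_eq_sum_order[OF nz'] by (simp add: degree_pderiv)
    finally have "Polynomial.order z (pderiv f) = 0" using ord' by simp
    then show False using z(2) nz' order_root by blast
  qed
  then have "Polynomial.order e ?p = 2"
    using z f e by (intro order_eq_2) (simp_all add: pderiv_diff_const crit_01_def)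
  then show False using ord f by (simp add: crit_01_def)
qed

section \<open>Field of coefficients and field of moduli\<close>

lemma DBP_over_Qbar: "f \<in> DBP \<Longrightarrow> over_Qbar f"
  by (simp add: DBP_def)

lemma over_Qbar_1: "over_Qbar 1"
  by (auto simp: over_Qbar_def Qbar_def)

text \<open>Critical points and points over 1 of the image polynomial pull back to those of f, while
  \<sigma> fixes 0 and 1 and preserves vanishing.\<close>

lemma crit_01_map_poly:
  assumes \<sigma>: "\<sigma> \<in> Galois_group" and Q: "over_Qbar f" and f: "crit_01 f"
  shows "crit_01 (map_poly \<sigma> f)"
proof -
  note Q' = over_Qbar_pderiv[OF Q]
  have deg: "Polynomial.degree f \<ge> 3" using f by (simp add: crit_01_def)
  have crit: "poly f z = 0 \<or> poly f z = 1" if "poly (pderiv f) z = 0" for z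
    using f that by (auto simp: crit_01_def)
  have one: "poly (pderiv f) z = 0" "poly (pderiv (pderiv f)) z \<noteq> 0" if "poly f z = 1" for z
    using f that by (auto simp: crit_01_def)
  have "poly (map_poly \<sigma> f) w \<in> {0, 1}" if w: "poly (pderiv (map_poly \<sigma> f)) w = 0" for w
  proof -
    have "pderiv f \<noteq> 0" using deg by (auto simp: pderiv_eq_0_iff)
    then obtain z where z: "z \<in> Qbar" "w = \<sigma> z" "poly (pderiv f) z = 0"
      using map_poly_Galois_rootE[OF \<sigma> Q'] w unfolding pderiv_map_poly_Galois[OF \<sigma> Q] by metis
    have "poly (map_poly \<sigma> f) w = \<sigma> (poly f z)"
      using poly_map_poly_Galois[OF \<sigma> Q z(1)] z(2) by simp
    then show ?thesis using crit[OF z(3)] Galois_Rats[OF \<sigma>, of 0] Galois_Rats[OF \<sigma>, of 1] by auto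
  qed
  moreover have "poly (pderiv (map_poly \<sigma> f)) w = 0 \<and> poly (pderiv (pderiv (map_poly \<sigma> f))) w \<noteq> 0"
    if w: "poly (map_poly \<sigma> f) w = 1" for w
  proof -
    have Q1: "over_Qbar (f - [:1:])"
      using Q Rats_subset_Qbar by (auto simp: over_Qbar_def coeff_pCons intro!: Qbar_diff split: nat.splits)
    have "map_poly \<sigma> (f - [:1:]) = map_poly \<sigma> f - [:1:]"
    proof (rule poly_eqI)
      fix i
      have "\<sigma> (x - 1) = \<sigma> x - 1" if "x \<in> Qbar" for x
      proof -
        have "-1 \<in> Qbar" by (simp add: Qbar_def)
        then show ?thesis
          using Galois_add[OF \<sigma> that, of "-1"] Galois_Rats[OF \<sigma>, of "-1"] by simp
      qed
      then show "Polynomial.coeff (map_poly \<sigma> (f - [:1:])) i = Polynomial.coeff (map_poly \<sigma> f - [:1:]) i"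
        using Q by (simp add: coeff_map_poly Galois_group_0[OF \<sigma>] over_Qbar_def coeff_pCons split: nat.splits)
    qed
    then have "poly (map_poly \<sigma> (f - [:1:])) w = 0" using w by simp
    moreover have "f - [:1:] \<noteq> 0" using deg degree_diff_const[of f 1] by auto
    ultimately obtain z where z: "z \<in> Qbar" "w = \<sigma> z" "poly (f - [:1:]) z = 0"
      using map_poly_Galois_rootE[OF \<sigma> Q1] by metis
    then show ?thesis
      using one[of z]
      by (simp add: pderiv_map_poly_Galois[OF \<sigma>] Q Q' poly_map_poly_Galois[OF \<sigma>] over_Qbar_pderiv
          Galois_eq_0_iff[OF \<sigma>] poly_in_Qbar Galois_group_0[OF \<sigma>])
  qed
  ultimately show ?thesis
    using deg unfolding crit_01_def degree_map_poly_Galois[OF \<sigma> Q] by blast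
qed

lemma crit_01_conj_eq:
  assumes f: "crit_01 f" and g: "crit_01 g" and M: "M \<in> Moebius"
    and conj: "ratmap g 1 \<circ> M = M \<circ> ratmap f 1"
  shows "g = f"
proof -
  obtain a b c d where det: "a * d - b * c \<noteq> 0" and M_eq: "M = moeb a b c d"
    using M by (rule MoebiusE)
  have M_Some: "M (Some z) = hpoint (a * z + b) (c * z + d)" for z
    using moeb_hpoint[OF det, of z 1] by (simp add: hpoint_def M_eq)
  have ratmap_1: "ratmap h 1 (Some z) = Some (poly h z)" for h z
    by (simp add: ratmap_def)
  have rel: "ratmap g 1 (M (Some z)) = M (Some (poly f z))" for z
    using fun_cong[OF conj, of "Some z"] by (simp add: ratmap_1)
  show ?thesis
  proof (cases "c = 0")
    case True
    then have "a \<noteq> 0" "d \<noteq> 0" using det by auto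
    have "poly g (a / d * z + b / d) = a / d * poly f z + b / d" for z
      using rel[of z] \<open>d \<noteq> 0\<close> True by (simp add: M_Some hpoint_def ratmap_1 add_divide_distrib)
    then show ?thesis using crit_01_affine_conj[OF f g, of "a / d" "b / d"] \<open>a \<noteq> 0\<close> \<open>d \<noteq> 0\<close> by simp
  next
    case False
    \<comment> \<open>The pole -d/c of M has a preimage z under f other than itself. M sends f(z) to
      infinity, while M z is finite and the polynomial g keeps it finite.\<close>
    obtain z where z: "z \<noteq> - d / c" "poly f z = - d / c"
      using crit_01_no_exceptional_point[OF f] by blast
    have "M (Some (poly f z)) = None" using z(2) False by (simp add: M_Some hpoint_def)
    moreover have "c * z + d \<noteq> 0" using z(1) False by (auto simp: field_simps add_eq_0_iff)
    ultimately show ?thesis using rel[of z] by (simp add: M_Some hpoint_def ratmap_1)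
  qed
qed

text \<open>Applying \<sigma> to the coefficients of M gives the new conjugating map. The relation
  is carried over by \<sigma> at algebraic points and by \<open>conj_relation_extends\<close> at the
  others.\<close>

lemma rat_conj_gal_rat:
  assumes \<sigma>: "\<sigma> \<in> Galois_group" and Q: "over_Qbar f" and fixed: "map_poly \<sigma> f = f"
    and conj: "(ratmap f 1, g) \<in> rat_conj n"
  shows "(ratmap f 1, gal_rat \<sigma> g) \<in> rat_conj n"
proof -
  obtain M where M: "ratmap f 1 \<in> Rat n" "g \<in> Rat n" "M \<in> Moebius" "g \<circ> M = M \<circ> ratmap f 1"
    using conj unfolding rat_conj_iff by blast
  obtain p q where pq: "over_Qbar p" "over_Qbar q" "coprime p q" "g = ratmap p q"
    using M(2) unfolding Rat_def by blast
  obtain a b c d where abcd: "a \<in> Qbar" "b \<in> Qbar" "c \<in> Qbar" "d \<in> Qbar" and det: "a * d - b * c \<noteq> 0"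
    and M_eq: "M = moeb a b c d" using M(3) by (rule MoebiusE)
  define g' where "g' = ratmap (map_poly \<sigma> p) (map_poly \<sigma> q)"
  define M' where "M' = moeb (\<sigma> a) (\<sigma> b) (\<sigma> c) (\<sigma> d)"
  have g': "gal_rat \<sigma> g = g'" unfolding g'_def pq(4) by (rule gal_rat_ratmap[OF \<sigma> pq(1-3)])
  have "\<sigma> (a * d - b * c) = \<sigma> a * \<sigma> d - \<sigma> b * \<sigma> c"
    using Galois_add[OF \<sigma>, of "a * d" "- (b * c)"] abcd
    by (simp add: Qbar_mult Qbar_uminus Galois_uminus[OF \<sigma>] Galois_group_mult[OF \<sigma>])
  then have det': "\<sigma> a * \<sigma> d - \<sigma> b * \<sigma> c \<noteq> 0"
    using det Galois_group_nonzero[OF \<sigma> _ det] abcd by (simp add: Qbar_diff Qbar_mult)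
  have over1: "over_Qbar 1" "map_poly \<sigma> 1 = 1"
    using Galois_Rats[OF \<sigma>, of 1] by (simp_all add: over_Qbar_1 map_poly_1')
  have over_M: "over_Qbar [:b, a:]" "over_Qbar [:d, c:]"
    using abcd by (auto simp: over_Qbar_def coeff_pCons Qbar_def split: nat.splits)
  have map_M: "map_poly \<sigma> [:b, a:] = [:\<sigma> b, \<sigma> a:]" "map_poly \<sigma> [:d, c:] = [:\<sigma> d, \<sigma> c:]"
    by (simp_all add: map_poly_pCons Galois_group_0[OF \<sigma>])
  have M_equiv: "M' (map_option \<sigma> w) = map_option \<sigma> (M w)" "set_option (M w) \<subseteq> Qbar"
    if "set_option w \<subseteq> Qbar" for w
    using ratmap_Galois[OF \<sigma> over_M that] by (simp_all add: map_M M'_def M_eq moeb_def)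
  have algebraic_points: "g' (M' w) = M' (ratmap f 1 w)" if w: "set_option w \<subseteq> Qbar" for w
  proof -
    have "\<exists>v. set_option v \<subseteq> Qbar \<and> w = map_option \<sigma> v"
    proof (cases w)
      case None
      then show ?thesis by (intro exI[of _ None]) simp
    next
      case (Some z)
      then obtain u where "u \<in> Qbar" "z = \<sigma> u" using w Galois_surjE[OF \<sigma>, of z] by auto
      then show ?thesis using Some by (intro exI[of _ "Some u"]) simp
    qed
    then obtain v where v: "set_option v \<subseteq> Qbar" "w = map_option \<sigma> v" by blast
    have F: "ratmap f 1 w = map_option \<sigma> (ratmap f 1 v)" "set_option (ratmap f 1 v) \<subseteq> Qbar"
      using ratmap_Galois[OF \<sigma> Q over1(1) v(1)] by (simp_all add: fixed over1(2) v(2))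
    have "g' (M' w) = map_option \<sigma> (g (M v))"
      unfolding v(2) M_equiv(1)[OF v(1)] g'_def pq(4)
      by (rule ratmap_Galois(1)[OF \<sigma> pq(1,2) M_equiv(2)[OF v(1)]])
    also have "g (M v) = M (ratmap f 1 v)" using fun_cong[OF M(4), of v] by simp
    also have "map_option \<sigma> \<dots> = M' (ratmap f 1 w)"
      unfolding F(1) by (rule M_equiv(1)[OF F(2), symmetric])
    finally show ?thesis .
  qed
  have ratmap_1: "ratmap f 1 (Some z) = Some (poly f z)" for z
    by (simp add: ratmap_def)
  have "g' (M' w) = M' (ratmap f 1 w)" for w
  proof (cases "set_option w \<subseteq> Qbar")
    case True
    then show ?thesis by (rule algebraic_points)
  next
    case False
    then obtain z where z: "w = Some z" "z \<notin> Qbar" by (cases w) auto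
    \<comment> \<open>The pole of M' is algebraic, so a transcendental z avoids it.\<close>
    have nz: "\<sigma> c * z + \<sigma> d \<noteq> 0"
    proof
      assume 0: "\<sigma> c * z + \<sigma> d = 0"
      then have "\<sigma> c \<noteq> 0" using det' by auto
      with 0 have "z = - \<sigma> d / \<sigma> c" by (simp add: field_simps add_eq_0_iff)
      then show False using z(2) abcd by (simp add: Qbar_divide Qbar_uminus Galois_closed[OF \<sigma>])
    qed
    show ?thesis
      unfolding z(1) ratmap_1 g'_def M'_def
    proof (rule conj_relation_extends[OF coprime_map_poly_Galois[OF \<sigma> pq(1-3)] det' _ nz])
      fix u assume "u \<in> Qbar"
      then have "g' (M' (Some u)) = M' (ratmap f 1 (Some u))" by (intro algebraic_points) simp
      then show "ratmap (map_poly \<sigma> p) (map_poly \<sigma> q) (moeb (\<sigma> a) (\<sigma> b) (\<sigma> c) (\<sigma> d) (Some u)) =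
          moeb (\<sigma> a) (\<sigma> b) (\<sigma> c) (\<sigma> d) (Some (poly f u))"
        unfolding ratmap_1 g'_def M'_def .
    qed
  qed
  then have "g' \<circ> M' = M' \<circ> ratmap f 1" by auto
  moreover have "M' \<in> Moebius"
    unfolding M'_def using abcd by (intro moeb_in_Moebius det' Galois_closed[OF \<sigma>])
  moreover have "g' \<in> Rat n" using gal_rat_in_Rat[OF \<sigma> M(2)] g' by simp
  ultimately show ?thesis using M(1) unfolding g' rat_conj_iff by blast
qed

text \<open>Membership in \<open>Qbar\<close> is carried through the induction because the
  homomorphism laws for \<sigma> hold only there.\<close>

lemma K_Coeff_fixed:
  assumes Q: "over_Qbar f" and \<sigma>: "\<sigma> \<in> Galois_group" and fixed: "map_poly \<sigma> f = f"
    and x: "x \<in> K_Coeff f"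
  shows "x \<in> Qbar \<and> \<sigma> x = x"
  using x unfolding K_Coeff_def
proof (induction rule: generate_field.induct)
  case one
  show ?case using Rats_subset_Qbar Galois_Rats[OF \<sigma>, of 1] by auto
next
  case (incl h)
  show ?case
  proof (cases "h \<in> \<rat>")
    case True
    then show ?thesis using Rats_subset_Qbar Galois_Rats[OF \<sigma>] by auto
  next
    case False
    then obtain i where i: "h = Polynomial.coeff f i" using incl by blast
    have "\<sigma> h = Polynomial.coeff (map_poly \<sigma> f) i" by (simp add: i coeff_map_poly Galois_group_0[OF \<sigma>])
    then show ?thesis using Q fixed by (simp add: i over_Qbar_def)
  qed
next
  case (a_inv h)
  then show ?case by (simp add: Qbar_uminus Galois_uminus[OF \<sigma>])
next
  case (m_inv h)
  then show ?case by (simp add: Qbar_inverse Galois_inverse[OF \<sigma>])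
next
  case (eng_add h1 h2)
  then show ?case by (simp add: Qbar_add Galois_add[OF \<sigma>])
next
  case (eng_mult h1 h2)
  then show ?case by (simp add: Qbar_mult Galois_group_mult[OF \<sigma>])
qed

lemma Galois_id: "restrict id Qbar \<in> Galois_group"
  using Rats_subset_Qbar Qbar_add Qbar_mult
  by (auto simp: Galois_group_def ring_iso_def ring_hom_def Qbar_ring_def ring_of_type_algebra_def
      bij_betw_def inj_on_def)

text \<open>The identity is an automorphism fixing f, so \<open>K_Coeff_fixed\<close> already
  contains this claim.\<close>

lemma K_Coeff_subset_Qbar:
  assumes "over_Qbar f"
  shows "K_Coeff f \<subseteq> Qbar"
proof -
  have "map_poly (restrict id Qbar) f = f"
    using assms Galois_group_0[OF Galois_id] by (intro poly_eqI) (simp add: coeff_map_poly over_Qbar_def)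
  then show ?thesis using K_Coeff_fixed[OF assms Galois_id] by blast
qed

lemma Stab_iff:
  assumes "f \<in> DBP" and \<sigma>: "\<sigma> \<in> Galois_group"
  shows "\<sigma> \<in> Stab (Polynomial.degree f) (conj_class (Polynomial.degree f) (ratmap f 1))
    \<longleftrightarrow> map_poly \<sigma> f = f"
proof -
  define n where "n = Polynomial.degree f"
  define F where "F = ratmap f 1"
  have Q: "over_Qbar f" using assms(1) by (rule DBP_over_Qbar)
  have over1: "over_Qbar 1" "map_poly \<sigma> 1 = 1"
    using Galois_Rats[OF \<sigma>, of 1] by (simp_all add: over_Qbar_1 map_poly_1')
  have F: "F \<in> Rat n" unfolding F_def n_def by (rule DBP_in_Rat[OF assms(1)])
  have gal: "gal_rat \<sigma> F = ratmap (map_poly \<sigma> f) 1"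
    using gal_rat_ratmap[OF \<sigma> Q over1(1)] by (simp add: F_def over1(2))
  have mem: "F \<in> conj_class n F" by (rule conj_class_self[OF F])
  have "\<sigma> \<in> Stab n (conj_class n F) \<longleftrightarrow> map_poly \<sigma> f = f"
  proof
    assume "\<sigma> \<in> Stab n (conj_class n F)"
    then have "conj_class n (gal_rat \<sigma> F) \<subseteq> conj_class n F"
      using mem unfolding Stab_def gal_class_def by blast
    then have "gal_rat \<sigma> F \<in> conj_class n F"
      using conj_class_self[OF gal_rat_in_Rat[OF \<sigma> F]] by (rule subsetD)
    then have "(F, gal_rat \<sigma> F) \<in> rat_conj n" by (simp add: conj_class_def)
    then obtain M where "M \<in> Moebius" "gal_rat \<sigma> F \<circ> M = M \<circ> F"
      unfolding rat_conj_iff by blast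
    then have M: "M \<in> Moebius" "ratmap (map_poly \<sigma> f) 1 \<circ> M = M \<circ> ratmap f 1"
      unfolding gal by (simp_all only: F_def)
    have "crit_01 f" by (rule DBP_crit_01[OF assms(1)])
    then show "map_poly \<sigma> f = f"
      by (rule crit_01_conj_eq[OF _ crit_01_map_poly[OF \<sigma> Q] M]) fact
  next
    assume fixed: "map_poly \<sigma> f = f"
    \<comment> \<open>\<open>gal_class\<close> is a union over all members of the class, so this
      direction must treat every g and not only the polynomial representative.\<close>
    have "conj_class n (gal_rat \<sigma> g) = conj_class n F" if "g \<in> conj_class n F" for g
    proof -
      have "(F, g) \<in> rat_conj n" using that by (simp add: conj_class_def)
      then have "(F, gal_rat \<sigma> g) \<in> rat_conj n"
        unfolding F_def by (rule rat_conj_gal_rat[OF \<sigma> Q fixed])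
      then show ?thesis by (rule conj_class_eq[symmetric])
    qed
    then have "gal_class n \<sigma> (conj_class n F) = conj_class n F"
      using mem unfolding gal_class_def by blast
    then show "\<sigma> \<in> Stab n (conj_class n F)" using \<sigma> by (simp add: Stab_def)
  qed
  then show ?thesis by (simp add: n_def F_def)
qed

theorem theorem5p2:
  fixes f :: "complex poly" and d :: nat
    and \<phi> :: "(complex option \<Rightarrow> complex option) set"
  assumes "f \<in> DBP"
    and "Polynomial.degree f = d"
    and "\<phi> = conj_class d (ratmap f 1)"
  shows "K_Coeff f = K_Moduli d \<phi>"
proof
  have Q: "over_Qbar f" using assms(1) by (rule DBP_over_Qbar)
  have Stab: "\<sigma> \<in> Stab d \<phi> \<longleftrightarrow> \<sigma> \<in> Galois_group \<and> map_poly \<sigma> f = f" for \<sigma>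
    using Stab_iff[OF assms(1)] assms(2,3) unfolding Stab_def by blast
  show "K_Coeff f \<subseteq> K_Moduli d \<phi>"
    using K_Coeff_fixed[OF Q] K_Coeff_subset_Qbar[OF Q] Stab unfolding K_Moduli_def by blast
  show "K_Moduli d \<phi> \<subseteq> K_Coeff f"
  proof (rule subsetI, rule ccontr)
    fix x assume x: "x \<in> K_Moduli d \<phi>" "x \<notin> K_Coeff f"
    have "x \<in> Qbar" using x(1) by (simp add: K_Moduli_def)
    have incl: "\<rat> \<union> range (Polynomial.coeff f) \<subseteq> K_Coeff f"
      unfolding K_Coeff_def by (blast intro: generate_field.incl)
    \<comment> \<open>Such an automorphism fixes all coefficients of f, so it lies in the stabiliser
      and cannot move x.\<close>
    have "\<exists>\<sigma>\<in>Galois_group. (\<forall>k\<in>K_Coeff f. \<sigma> k = k) \<and> \<sigma> x \<noteq> x"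
    proof (rule Galois_group_moves[OF K_Coeff_subset_Qbar[OF Q] _ _ _ \<open>x \<in> Qbar\<close> x(2)])
      show "\<rat> \<subseteq> K_Coeff f" using incl by blast
      fix y z assume "y \<in> K_Coeff f" "z \<in> K_Coeff f"
      then show "y + z \<in> K_Coeff f" "y * z \<in> K_Coeff f"
        using generate_field.eng_add[of y "ring_of_type_algebra :: complex ring"]
          generate_field.eng_mult[of y "ring_of_type_algebra :: complex ring"]
        unfolding K_Coeff_def by simp_all
    qed
    then obtain \<sigma> where \<sigma>: "\<sigma> \<in> Galois_group" "\<And>k. k \<in> K_Coeff f \<Longrightarrow> \<sigma> k = k" "\<sigma> x \<noteq> x"
      by blast
    have "map_poly \<sigma> f = f"
    proof (rule poly_eqI)
      fix i
      have "Polynomial.coeff f i \<in> K_Coeff f" using incl by blast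
      then show "Polynomial.coeff (map_poly \<sigma> f) i = Polynomial.coeff f i"
        using \<sigma>(2) by (simp add: coeff_map_poly Galois_group_0[OF \<sigma>(1)])
    qed
    then show False using x(1) \<sigma> Stab unfolding K_Moduli_def by blast
  qed
qed

end
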